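(* Let $X$ be a connected smooth manifold, $x_0\in X$, and let $s\ge0$ be an integer. The restriction map $$B_s(X)_{x_0}^{\mathrm{hom}}\longrightarrow B_s(X)_{x_0,x_0}^{\mathrm{hom}}$$ is surjective.
   Context: Path spaces: $PX$ is the set of all smooth maps $p:[0,1]\to X$; $PX_{x_0}$ is the subset of paths starting at $x_0$; $PX_{x_0,x_0}$ is the subset of loops at $x_0$. Iterated integrals: for a path $p$ and smooth $1$-forms $\omega_1,\dots,\omega_r$ on $X$, $$\int_p\omega_1\cdots\omega_r=\int_0^1\int_0^{t_r}\cdots\int_0^{t_2}p^*\omega_1(t_1)\,p^*\omega_2(t_2)\cdots p^*\omega_r(t_r).$$ $B_s(X)$ is the space of all maps $PX\to\mathbb C$ which are linear combinations of maps $p\mapsto\int_p\omega_1\cdots\omega_r$ with $r\le s$ (constants are included as iterated integrals of length $0$). $B_s(X)_{x_0}$ and $B_s(X)_{x_0,x_0}$ are the sets of restrictions of elements of $B_s(X)$ to $PX_{x_0}$ and $PX_{x_0,x_0}$ respectively. The superscript $\mathrm{hom}$ denotes the subspace of those elements which are invariant under homotopies of paths with fixed end-points. The restriction map restricts functions on $PX_{x_0}$ to $PX_{x_0,x_0}$. *)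

theory Defs
  imports "HOL-Analysis.Analysis"
begin

section \<open>Smooth maps\<close>

text \<open>
  The derivative is taken within \<open>S\<close>, so that the same notion serves for relatively open subsets
  of \<open>{0..1}\<close> (one-sided derivatives at the end-points) and for relatively open subsets of a linear
  subspace \<open>E\<close> of the ambient type. In the latter case \<open>f' x\<close> is determined along \<open>E\<close> only and its
  values off \<open>E\<close> may be chosen freely, e.g. by precomposing with the projection onto \<open>E\<close>.
\<close>

primrec Ck_on :: "nat \<Rightarrow> 'v::real_normed_vector set \<Rightarrow> ('v \<Rightarrow> 'w::real_normed_vector) \<Rightarrow> bool" where
  "Ck_on 0 S f \<longleftrightarrow> continuous_on S f"
| "Ck_on (Suc k) S f \<longleftrightarrow>
     (\<exists>f'. (\<forall>x\<in>S. (f has_derivative f' x) (at x within S)) \<and> (\<forall>v. Ck_on k S (\<lambda>x. f' x v)))"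

definition smooth_on :: "'v::real_normed_vector set \<Rightarrow> ('v \<Rightarrow> 'w::real_normed_vector) \<Rightarrow> bool" where
  "smooth_on S f \<longleftrightarrow> (\<forall>k. Ck_on k S f)"

section \<open>Smooth manifolds, smooth paths and smooth 1-forms\<close>

text \<open>
  A chart is a pair \<open>(U, \<phi>)\<close>. Its values lie in a linear subspace \<open>E\<close> of a Euclidean type,
  which plays the role of \<open>\<real>\<^sup>n\<close> with \<open>n = dim E\<close>; since every Euclidean type has positive dimension,
  this is what admits \<open>n = 0\<close>. The Hausdorff and second countability axioms are expressed by
  the sort of \<open>'a\<close>, and \<open>X\<close> carries the subspace topology (\<open>X = UNIV\<close> is allowed). The atlas need not
  be maximal: smooth paths and forms are the same for an atlas and for the maximal atlas it generates.
\<close>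

type_synonym ('a, 'e) chart = "'a set \<times> ('a \<Rightarrow> 'e)"

definition smooth_manifold ::
    "'e::euclidean_space set \<Rightarrow> 'a::{t2_space, second_countable_topology} set \<Rightarrow> ('a, 'e) chart set \<Rightarrow> bool"
  where
  "smooth_manifold E X A \<longleftrightarrow>
     subspace E \<and>
     (\<Union>(U, \<phi>)\<in>A. U) = X \<and>
     (\<forall>(U, \<phi>)\<in>A. openin (top_of_set X) U \<and> openin (top_of_set E) (\<phi> ` U) \<and>
        homeomorphism U (\<phi> ` U) \<phi> (inv_into U \<phi>)) \<and>
     (\<forall>(U, \<phi>)\<in>A. \<forall>(W, \<psi>)\<in>A. smooth_on (\<phi> ` (U \<inter> W)) (\<psi> \<circ> inv_into U \<phi>))"

text \<open>A path is a function on all of \<open>\<real>\<close>, of which only the values on \<open>{0..1}\<close> matter.\<close>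

definition paths :: "'a::topological_space set \<Rightarrow> ('a, 'e::real_normed_vector) chart set \<Rightarrow> (real \<Rightarrow> 'a) set" where
  "paths X A = {p. path p \<and> path_image p \<subseteq> X \<and>
     (\<forall>(U, \<phi>)\<in>A. smooth_on ({0..1} \<inter> p -` U) (\<phi> \<circ> p))}"

definition paths_from ::
    "'a::topological_space set \<Rightarrow> ('a, 'e::real_normed_vector) chart set \<Rightarrow> 'a \<Rightarrow> (real \<Rightarrow> 'a) set" where
  "paths_from X A x0 = {p \<in> paths X A. pathstart p = x0}"

definition loops_at ::
    "'a::topological_space set \<Rightarrow> ('a, 'e::real_normed_vector) chart set \<Rightarrow> 'a \<Rightarrow> (real \<Rightarrow> 'a) set" where
  "loops_at X A x0 = {p \<in> paths X A. pathstart p = x0 \<and> pathfinish p = x0}"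

text \<open>
  A complex-valued 1-form is given by its local representatives: \<open>\<omega> (U, \<phi>) m v\<close> is the value of the form
  at \<open>m \<in> U\<close> on the tangent vector that has coordinates \<open>v \<in> E\<close> in the chart \<open>(U, \<phi>)\<close>. Representatives in
  different charts are related by the derivative \<open>D\<close> of the change of coordinates (which is unique
  along \<open>E\<close>).
\<close>

type_synonym ('a, 'e) form = "('a, 'e) chart \<Rightarrow> 'a \<Rightarrow> 'e \<Rightarrow> complex"

definition smooth_forms :: "'e::real_normed_vector set \<Rightarrow> ('a, 'e) chart set \<Rightarrow> ('a, 'e) form set" where
  "smooth_forms E A = {\<omega>.
     (\<forall>(U, \<phi>)\<in>A. \<forall>m\<in>U. linear (\<omega> (U, \<phi>) m)) \<and>
     (\<forall>(U, \<phi>)\<in>A. \<forall>(W, \<psi>)\<in>A. \<forall>m\<in>U \<inter> W. \<forall>D.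
        ((\<psi> \<circ> inv_into U \<phi>) has_derivative D) (at (\<phi> m) within \<phi> ` (U \<inter> W)) \<longrightarrow>
        (\<forall>v\<in>E. \<omega> (U, \<phi>) m v = \<omega> (W, \<psi>) m (D v))) \<and>
     (\<forall>(U, \<phi>)\<in>A. \<forall>v\<in>E. smooth_on (\<phi> ` U) (\<lambda>y. \<omega> (U, \<phi>) (inv_into U \<phi> y) v))}"

section \<open>Iterated integrals\<close>

text \<open>
  The coefficient of \<open>dt\<close> in \<open>p\<^sup>*\<omega>\<close>. By the transformation rule for forms it does not depend on
  the chosen chart around \<open>p t\<close>.
\<close>

definition pullback :: "('a, 'e::real_normed_vector) chart set \<Rightarrow> (real \<Rightarrow> 'a) \<Rightarrow> ('a, 'e) form \<Rightarrow> real \<Rightarrow> complex" where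
  "pullback A p \<omega> t =
     (let c = (SOME c. c \<in> A \<and> p t \<in> fst c)
      in \<omega> c (p t) (vector_derivative (snd c \<circ> p) (at t within {0..1})))"

text \<open>
  The list is consumed from the outermost integration inwards, i.e. it is \<open>[f\<^sub>r, \<dots>, f\<^sub>1]\<close>; hence the
  reversal in the definition of the iterated integral of \<open>[\<omega>\<^sub>1, \<dots>, \<omega>\<^sub>r]\<close>.
\<close>

primrec nested_integral :: "(real \<Rightarrow> complex) list \<Rightarrow> real \<Rightarrow> complex" where
  "nested_integral [] T = 1"
| "nested_integral (f # fs) T = integral {0..T} (\<lambda>t. nested_integral fs t * f t)"

definition iterated_integral ::
    "('a, 'e::real_normed_vector) chart set \<Rightarrow> ('a, 'e) form list \<Rightarrow> (real \<Rightarrow> 'a) \<Rightarrow> complex" where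
  "iterated_integral A \<omega>s p = nested_integral (map (pullback A p) (rev \<omega>s)) 1"

text \<open>
  Functions on a set \<open>P\<close> of paths are represented by elements of \<open>extensional P\<close>, so that
  \<open>restrict\<close> is the restriction of functions.
\<close>

definition B_paths :: "'e::real_normed_vector set \<Rightarrow> 'a::topological_space set \<Rightarrow> ('a, 'e) chart set \<Rightarrow> nat
    \<Rightarrow> ((real \<Rightarrow> 'a) \<Rightarrow> complex) set" where
  "B_paths E X A s = {restrict (\<lambda>p. \<Sum>i<n. c i * iterated_integral A (w i) p) (paths X A) | (n::nat) c w.
     \<forall>i<n. length (w i) \<le> s \<and> set (w i) \<subseteq> smooth_forms E A}"

definition B_from :: "'e::real_normed_vector set \<Rightarrow> 'a::topological_space set \<Rightarrow> ('a, 'e) chart set \<Rightarrow> nat \<Rightarrow> 'a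
    \<Rightarrow> ((real \<Rightarrow> 'a) \<Rightarrow> complex) set" where
  "B_from E X A s x0 = (\<lambda>F. restrict F (paths_from X A x0)) ` B_paths E X A s"

definition B_loops :: "'e::real_normed_vector set \<Rightarrow> 'a::topological_space set \<Rightarrow> ('a, 'e) chart set \<Rightarrow> nat \<Rightarrow> 'a
    \<Rightarrow> ((real \<Rightarrow> 'a) \<Rightarrow> complex) set" where
  "B_loops E X A s x0 = (\<lambda>F. restrict F (loops_at X A x0)) ` B_paths E X A s"

definition homotopy_invariant ::
    "'a::topological_space set \<Rightarrow> (real \<Rightarrow> 'a) set \<Rightarrow> ((real \<Rightarrow> 'a) \<Rightarrow> complex) \<Rightarrow> bool" where
  "homotopy_invariant X P F \<longleftrightarrow> (\<forall>p\<in>P. \<forall>q\<in>P. homotopic_paths X p q \<longrightarrow> F p = F q)"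

definition B_from_hom :: "'e::real_normed_vector set \<Rightarrow> 'a::topological_space set \<Rightarrow> ('a, 'e) chart set \<Rightarrow> nat \<Rightarrow> 'a
    \<Rightarrow> ((real \<Rightarrow> 'a) \<Rightarrow> complex) set" where
  "B_from_hom E X A s x0 = {F \<in> B_from E X A s x0. homotopy_invariant X (paths_from X A x0) F}"

definition B_loops_hom :: "'e::real_normed_vector set \<Rightarrow> 'a::topological_space set \<Rightarrow> ('a, 'e) chart set \<Rightarrow> nat \<Rightarrow> 'a
    \<Rightarrow> ((real \<Rightarrow> 'a) \<Rightarrow> complex) set" where
  "B_loops_hom E X A s x0 = {F \<in> B_loops E X A s x0. homotopy_invariant X (loops_at X A x0) F}"

end

(* The idea: let F be a combination of iterated integrals whose restriction to the loops at x0 is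
   homotopy invariant. If x is the end-point of a path p and r is a path from x back to x0, then
   p |-> F(p r) is homotopy invariant. Averaging over finitely many return paths r_k(x), which depend
   smoothly on x in a chart ball B_k, with a smooth partition of unity rho_k gives
   G(p) = sum_k rho_k(x) F(p r_k(x)), which is homotopy invariant on paths from x0 and agrees with F on
   loops as soon as r_k(x0) is constant whenever x0 lies in B_k.
   By the composition formula for iterated integrals G(p) is a sum of terms a(x) I(w_1 ... w_j)(p) with
   smooth functions a, and a = 1 when w_1 ... w_j has full length. Integration by parts,
   a(x) I(w_1 ... w_j) = I(w_1 ... w_j da) + I(w_1 ... (a w_j)), turns such a term into iterated integrals
   of length at most j + 1, so G does not leave the space of length s. *)

theory Submission
  imports Defs
begin

section \<open>Functions of class C^k\<close>

text \<open>A continuous choice of return path over all of X would contract X, so in general there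
  is none, and a choice that jumps makes F(p r(x)) jump with the class of r(x). Averaging the values
  of F, which are numbers, avoids this: weights that depend on the end-point alone preserve homotopy
  invariance, since homotopies fix the end-point. The weights must sum to exactly 1. This gives
  agreement with F on loops, and it makes the coefficient of every undivided word constant; only
  strictly shorter words carry a variable coefficient, and they have room for the extra letter da.
  The family of return paths is countable, with finiteness at each end-point and uniformly near it.
  Two technical obstacles shape the rest. Concatenation of smooth paths produces a corner, so it is
  done with clocks that rest at the junction. Chart images lie in a subspace E of the ambient type
  and derivatives are taken within sets, so a derivative is determined only along E; a projection P
  onto E picks a canonical one.\<close>

lemma Ck_on_subset: "Ck_on k S f \<Longrightarrow> T \<subseteq> S \<Longrightarrow> Ck_on k T f"
proof (induction k arbitrary: f)
  case 0
  then show ?case by (auto intro: continuous_on_subset)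
next
  case (Suc k)
  then obtain f' where "\<forall>x\<in>S. (f has_derivative f' x) (at x within S)" "\<forall>v. Ck_on k S (\<lambda>x. f' x v)"
    by auto
  with Suc show ?case
    by (auto intro!: exI[of _ f'] intro: has_derivative_subset)
qed

lemma Ck_on_cong:
  assumes "Ck_on k S f" "\<And>x. x \<in> S \<Longrightarrow> f x = g x"
  shows "Ck_on k S g"
proof (cases k)
  case 0
  then show ?thesis using assms by (auto cong: continuous_on_cong)
next
  case (Suc j)
  then obtain f' where f': "\<forall>x\<in>S. (f has_derivative f' x) (at x within S)" "\<forall>v. Ck_on j S (\<lambda>x. f' x v)"
    using assms by auto
  moreover have "\<forall>x\<in>S. (g has_derivative f' x) (at x within S)"
    using f' assms(2) by (metis has_derivative_transform)
  ultimately show ?thesis using Suc by auto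
qed

lemma Ck_on_SucD: "Ck_on (Suc k) S f \<Longrightarrow> Ck_on k S f"
proof (induction k arbitrary: f)
  case 0
  then show ?case by (auto intro: has_derivative_continuous_on)
next
  case (Suc k)
  then obtain f' where f': "\<forall>x\<in>S. (f has_derivative f' x) (at x within S)" "\<forall>v. Ck_on (Suc k) S (\<lambda>x. f' x v)"
    by auto
  then have "\<forall>v. Ck_on k S (\<lambda>x. f' x v)" using Suc.IH by blast
  with f' show ?case by (auto simp del: Ck_on.simps simp: Ck_on.simps(2))
qed

lemma Ck_on_imp_continuous_on: "Ck_on k S f \<Longrightarrow> continuous_on S f"
proof (induction k)
  case (Suc k)
  show ?case by (rule Suc.IH[OF Ck_on_SucD[OF Suc.prems]])
qed simp

lemma Ck_on_const: "Ck_on k S (\<lambda>x. c)"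
  by (induction k arbitrary: c) (auto intro!: exI[of _ "\<lambda>x v. 0"])

lemma Ck_on_linear: "bounded_linear f \<Longrightarrow> Ck_on k S f"
proof (cases k)
  case 0
  assume "bounded_linear f"
  with 0 show ?thesis by (simp add: linear_continuous_on)
next
  case (Suc j)
  assume "bounded_linear f"
  with Suc show ?thesis
    by (auto intro!: exI[of _ "\<lambda>x. f"] Ck_on_const bounded_linear_imp_has_derivative)
qed

lemma Ck_on_add: "Ck_on k S f \<Longrightarrow> Ck_on k S g \<Longrightarrow> Ck_on k S (\<lambda>x. f x + g x)"
proof (induction k arbitrary: f g)
  case 0
  then show ?case by (auto intro: continuous_on_add)
next
  case (Suc k)
  then obtain f' g' where "\<forall>x\<in>S. (f has_derivative f' x) (at x within S)" "\<forall>v. Ck_on k S (\<lambda>x. f' x v)"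
    "\<forall>x\<in>S. (g has_derivative g' x) (at x within S)" "\<forall>v. Ck_on k S (\<lambda>x. g' x v)"
    by auto
  with Suc.IH show ?case
    by (auto intro!: exI[of _ "\<lambda>x v. f' x v + g' x v"] has_derivative_add)
qed

lemma Ck_on_sum: "(\<And>i. i \<in> I \<Longrightarrow> Ck_on k S (f i)) \<Longrightarrow> Ck_on k S (\<lambda>x. \<Sum>i\<in>I. f i x)"
  by (induction I rule: infinite_finite_induct) (auto intro: Ck_on_const Ck_on_add)

lemma Ck_on_bilinear:
  assumes "bounded_bilinear prd" "Ck_on k S f" "Ck_on k S g"
  shows "Ck_on k S (\<lambda>x. prd (f x) (g x))"
  using assms(2,3)
proof (induction k arbitrary: f g)
  case 0
  then show ?case using bounded_bilinear.continuous_on[OF assms(1)] by auto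
next
  case (Suc k)
  then obtain f' g' where d: "\<forall>x\<in>S. (f has_derivative f' x) (at x within S)" "\<forall>v. Ck_on k S (\<lambda>x. f' x v)"
    "\<forall>x\<in>S. (g has_derivative g' x) (at x within S)" "\<forall>v. Ck_on k S (\<lambda>x. g' x v)"
    by auto
  have "Ck_on k S f" "Ck_on k S g" using Suc.prems Ck_on_SucD by blast+
  with d Suc.IH show ?case
    by (auto intro!: exI[of _ "\<lambda>x v. prd (f x) (g' x v) + prd (f' x v) (g x)"] Ck_on_add
        bounded_bilinear.FDERIV[OF assms(1)])
qed

lemmas Ck_on_mult = Ck_on_bilinear[OF bounded_bilinear_mult]
  and Ck_on_scaleR = Ck_on_bilinear[OF bounded_bilinear_scaleR]
  and Ck_on_inner = Ck_on_bilinear[OF bounded_bilinear_inner]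

lemma linear_Basis_expand:
  fixes f :: "'v::euclidean_space \<Rightarrow> 'w::real_normed_vector"
  assumes "linear f"
  shows "f v = (\<Sum>b\<in>Basis. (v \<bullet> b) *\<^sub>R f b)"
proof -
  have "f v = f (\<Sum>b\<in>Basis. (v \<bullet> b) *\<^sub>R b)" by (simp add: euclidean_representation)
  also have "\<dots> = (\<Sum>b\<in>Basis. (v \<bullet> b) *\<^sub>R f b)"
    using assms by (simp add: linear_sum linear_cmul)
  finally show ?thesis .
qed

text \<open>The chain rule gives \<open>g' (f x) (f' x v)\<close>, where the direction itself moves
  with x, while \<open>Ck_on\<close> controls \<open>g'\<close> only in fixed directions. Expanding
  \<open>f' x v\<close> in \<open>Basis\<close> turns this into a sum of products of C^k functions;
  this is where the middle type must be Euclidean.\<close>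

lemma Ck_on_compose:
  fixes f :: "'u::real_normed_vector \<Rightarrow> 'v::euclidean_space"
    and g :: "'v \<Rightarrow> 'w::real_normed_vector"
  assumes "Ck_on k T g" "Ck_on k S f" "f ` S \<subseteq> T"
  shows "Ck_on k S (\<lambda>x. g (f x))"
  using assms(1,2)
proof (induction k arbitrary: g)
  case 0
  then show ?case using assms(3) by (auto intro: continuous_on_compose2)
next
  case (Suc k)
  then obtain f' g' where d: "\<forall>x\<in>S. (f has_derivative f' x) (at x within S)" "\<forall>v. Ck_on k S (\<lambda>x. f' x v)"
    "\<forall>x\<in>T. (g has_derivative g' x) (at x within T)" "\<forall>v. Ck_on k T (\<lambda>x. g' x v)"
    by auto
  have fk: "Ck_on k S f" using Suc.prems Ck_on_SucD by blast
  have "((\<lambda>x. g (f x)) has_derivative (\<lambda>v. g' (f x) (f' x v))) (at x within S)" if "x \<in> S" for x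
  proof (rule has_derivative_in_compose[where f = f and f' = "f' x" and g = g and g' = "g' (f x)"])
    show "(f has_derivative f' x) (at x within S)" using d that by blast
    show "(g has_derivative g' (f x)) (at (f x) within f ` S)"
      using d that assms(3) has_derivative_subset by blast
  qed
  moreover have "Ck_on k S (\<lambda>x. g' (f x) (f' x v))" for v
  proof (rule Ck_on_cong)
    have "Ck_on k S (\<lambda>x. g' (f x) b)" for b
      by (rule Suc.IH[OF spec[OF d(4)] fk])
    moreover have "Ck_on k S (\<lambda>x. f' x v \<bullet> b)" for b
      by (rule Ck_on_inner[OF spec[OF d(2)] Ck_on_const])
    ultimately show "Ck_on k S (\<lambda>x. \<Sum>b\<in>Basis. (f' x v \<bullet> b) *\<^sub>R g' (f x) b)"
      by (intro Ck_on_sum Ck_on_scaleR)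
    fix x assume "x \<in> S"
    then have "linear (g' (f x))" using d assms(3)
      by (meson has_derivative_linear image_subset_iff)
    then show "(\<Sum>b\<in>Basis. (f' x v \<bullet> b) *\<^sub>R g' (f x) b) = g' (f x) (f' x v)"
      by (rule linear_Basis_expand[symmetric])
  qed
  ultimately show ?case
    unfolding Ck_on.simps by (intro exI[of _ "\<lambda>x v. g' (f x) (f' x v)"] conjI ballI allI)
qed

lemma Ck_on_Pair:
  assumes "Ck_on k S f" "Ck_on k S g"
  shows "Ck_on k S (\<lambda>x. (f x, g x))"
  using assms
proof (induction k arbitrary: f g)
  case 0
  then show ?case by (auto intro: continuous_on_Pair)
next
  case (Suc k)
  then obtain f' g' where "\<forall>x\<in>S. (f has_derivative f' x) (at x within S)" "\<forall>v. Ck_on k S (\<lambda>x. f' x v)"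
    "\<forall>x\<in>S. (g has_derivative g' x) (at x within S)" "\<forall>v. Ck_on k S (\<lambda>x. g' x v)"
    by auto
  with Suc.IH show ?case
    by (auto intro!: exI[of _ "\<lambda>x v. (f' x v, g' x v)"] has_derivative_Pair)
qed

text \<open>Repeated differentiation under the integral sign: the derivative in direction v is again
  a parameter integral, of \<open>g' (x, t) (v, 0)\<close>, so the induction runs over arbitrary
  integrands. Convexity of S is a hypothesis of \<open>leibniz_rule\<close>.\<close>

lemma Ck_on_integral:
  fixes g :: "'u::euclidean_space \<Rightarrow> real \<Rightarrow> 'w::euclidean_space"
  assumes "Ck_on k (S \<times> {0..1}) (\<lambda>z. g (fst z) (snd z))" "convex S"
  shows "Ck_on k S (\<lambda>x. integral {0..1} (g x))"
  using assms(1)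
proof (induction k arbitrary: g)
  case 0
  then have "continuous_on (S \<times> cbox 0 1) (\<lambda>(x, t). g x t)"
    by (simp add: case_prod_unfold)
  then have "continuous_on S (\<lambda>x. integral (cbox 0 1) (g x))"
    by (rule integral_continuous_on_param)
  then show ?case by simp
next
  case (Suc k)
  define G where "G z = g (fst z) (snd z)" for z
  have "Ck_on (Suc k) (S \<times> {0..1}) G" using Suc.prems unfolding G_def .
  then obtain g' where
      d: "\<forall>z\<in>S \<times> {0..1}. (G has_derivative g' z) (at z within S \<times> {0..1})"
      and d': "\<forall>v. Ck_on k (S \<times> {0..1}) (\<lambda>z. g' z v)"
    unfolding Ck_on.simps by blast
  have cont: "continuous_on (S \<times> {0..1}) G"
    using d by (auto intro: has_derivative_continuous_on)
  \<comment> \<open>\<open>leibniz_rule\<close> wants the partial derivative as a jointly continuous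
    family of bounded linear maps; in finite dimension continuity in each direction is enough for
    that.\<close>
  define h where "h x t = Blinfun (\<lambda>v. g' (x, t) (v, 0))" for x t
  have lin: "bounded_linear (\<lambda>v. g' (x, t) (v, 0))" if "x \<in> S" "t \<in> {0..1}" for x t
  proof -
    have "bounded_linear (g' (x, t))" using d that has_derivative_bounded_linear by blast
    moreover have "bounded_linear (\<lambda>v::'u. (v, 0::real))"
      by (intro bounded_linear_Pair bounded_linear_ident bounded_linear_zero)
    ultimately show ?thesis using bounded_linear_compose by fastforce
  qed
  have h: "blinfun_apply (h x t) = (\<lambda>v. g' (x, t) (v, 0))" if "x \<in> S" "t \<in> {0..1}" for x t
    unfolding h_def by (rule bounded_linear_Blinfun_apply[OF lin[OF that]])
  have gc: "continuous_on {0..1} (g x)" if "x \<in> S" for x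
  proof -
    have "continuous_on {0..1} (\<lambda>t. G (x, t))"
      by (rule continuous_on_compose2[OF cont]) (use that in \<open>auto intro!: continuous_intros\<close>)
    then show ?thesis by (simp add: G_def)
  qed
  have hc: "continuous_on (S \<times> {0..1}) (\<lambda>(x, t). h x t)"
  proof (rule continuous_on_blinfun_componentwise)
    fix i :: 'u
    have "continuous_on (S \<times> {0..1}) (\<lambda>z. g' z (i, 0))"
      using d' Ck_on_imp_continuous_on by blast
    then show "continuous_on (S \<times> {0..1}) (\<lambda>x. blinfun_apply (case x of (x, xa) \<Rightarrow> h x xa) i)"
      by (rule continuous_on_eq) (auto simp: h)
  qed
  have deriv: "((\<lambda>x. integral (cbox 0 1) (g x)) has_derivative integral (cbox 0 1) (h x)) (at x within S)"
    if x: "x \<in> S" for x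
  proof (rule leibniz_rule)
    fix y t assume "y \<in> S" "t \<in> cbox 0 (1::real)"
    then have t: "y \<in> S" "t \<in> {0..1}" by auto
    have "((\<lambda>y. G (y, t)) has_derivative (\<lambda>v. g' (y, t) (v, 0))) (at y within S)"
    proof (rule has_derivative_in_compose[where f = "\<lambda>y. (y, t)" and f' = "\<lambda>v. (v, 0)" and g = G
          and g' = "g' (y, t)"])
      show "((\<lambda>y. (y, t)) has_derivative (\<lambda>v. (v, 0))) (at y within S)"
        by (auto intro!: derivative_eq_intros)
      show "(G has_derivative g' (y, t)) (at (y, t) within (\<lambda>y. (y, t)) ` S)"
        by (rule has_derivative_subset[of _ _ _ "S \<times> {0..1}"]) (use d t in auto)
    qed
    then show "((\<lambda>x. g x t) has_derivative blinfun_apply (h y t)) (at y within S)"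
      using t by (simp add: h G_def)
  next
    fix y assume "y \<in> S"
    then show "g y integrable_on cbox 0 1" using gc by (simp add: integrable_continuous_interval)
  qed (use x assms(2) hc in auto)
  have hi: "h x integrable_on {0..1}" if "x \<in> S" for x
  proof (rule integrable_continuous_interval)
    have "continuous_on {0..1} (\<lambda>t. case (x, t) of (x, t) \<Rightarrow> h x t)"
      by (rule continuous_on_compose2[OF hc]) (use that in \<open>auto intro!: continuous_intros\<close>)
    then show "continuous_on {0..1} (h x)" by simp
  qed
  have "Ck_on k S (\<lambda>x. blinfun_apply (integral {0..1} (h x)) v)" for v
  proof (rule Ck_on_cong)
    have "Ck_on k (S \<times> {0..1}) (\<lambda>z. (\<lambda>x t. g' (x, t) (v, 0)) (fst z) (snd z))"
      using d' by simp
    then show "Ck_on k S (\<lambda>x. integral {0..1} (\<lambda>t. g' (x, t) (v, 0)))"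
      by (rule Suc.IH)
    fix x assume x: "x \<in> S"
    have "integral {0..1} (\<lambda>t. g' (x, t) (v, 0)) = integral {0..1} (\<lambda>t. blinfun_apply (h x t) v)"
      by (rule integral_cong) (use x h in auto)
    also have "\<dots> = blinfun_apply (integral {0..1} (h x)) v"
      using integral_linear[OF hi[OF x] bounded_linear_apply_blinfun[of v]] by (simp add: o_def)
    finally show "integral {0..1} (\<lambda>t. g' (x, t) (v, 0)) = blinfun_apply (integral {0..1} (h x)) v" .
  qed
  with deriv show ?case
    unfolding Ck_on.simps cbox_interval
    by (intro exI[of _ "\<lambda>x. blinfun_apply (integral {0..1} (h x))"] conjI ballI allI)
qed

lemma Ck_on_SucI_real:
  fixes f :: "real \<Rightarrow> real"
  assumes "\<And>x. x \<in> S \<Longrightarrow> (f has_field_derivative g x) (at x within S)" "Ck_on k S g"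
  shows "Ck_on (Suc k) S f"
proof -
  have "Ck_on k S (\<lambda>x. g x * v)" for v
    by (rule Ck_on_mult[OF assms(2) Ck_on_const])
  moreover have "\<forall>x\<in>S. (f has_derivative (\<lambda>v. g x * v)) (at x within S)"
    using assms(1) by (auto simp: has_field_derivative_def)
  ultimately show ?thesis unfolding Ck_on.simps by (intro exI[of _ "\<lambda>x v. g x * v"]) auto
qed

section \<open>Bump functions\<close>

text \<open>The function exp(-1/t) / t^n extended by 0. The exponent is carried along because
  differentiation leads to the members n + 1 and n + 2 of the same family, so one induction proves
  all of them smooth.\<close>

definition flat_exp :: "nat \<Rightarrow> real \<Rightarrow> real" where
  "flat_exp n t = (if t > 0 then exp (- inverse t) * inverse t ^ n else 0)"

lemma flat_exp_tendsto_0: "(flat_exp n \<longlongrightarrow> 0) (at 0)"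
proof -
  have "((\<lambda>t::real. inverse t ^ n / exp (inverse t)) \<longlongrightarrow> 0) (at_right 0)"
    by (rule filterlim_compose[OF tendsto_power_div_exp_0 filterlim_inverse_at_top_right])
  then have "(flat_exp n \<longlongrightarrow> 0) (at_right 0)"
    by (rule Lim_transform_eventually)
       (auto simp: eventually_at_filter flat_exp_def exp_minus field_simps)
  moreover have "(flat_exp n \<longlongrightarrow> 0) (at_left 0)"
    by (rule Lim_transform_eventually[OF tendsto_const])
       (auto simp: eventually_at_filter flat_exp_def)
  ultimately show ?thesis by (simp add: filterlim_at_split)
qed

lemma flat_exp_has_derivative:
  "(flat_exp n has_field_derivative flat_exp (n + 2) t - of_nat n * flat_exp (n + 1) t) (at t)"
proof -
  consider "t > 0" | "t < 0" | "t = 0" by linarith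
  then show ?thesis
  proof cases
    case 1
    have "(inverse has_field_derivative - (inverse t ^ 2)) (at t)"
      using DERIV_inverse[of t UNIV] 1 by (simp add: power2_eq_square)
    from DERIV_mult[OF DERIV_chain2[OF DERIV_exp DERIV_minus[OF this]] DERIV_power[OF this, of n]]
    have "((\<lambda>t. exp (- inverse t) * inverse t ^ n) has_field_derivative
        (exp (- inverse t) * inverse t ^ 2) * inverse t ^ n
        + (of_nat n * inverse t ^ (n - 1) * - (inverse t ^ 2)) * exp (- inverse t)) (at t)"
      by (simp add: mult_ac)
    moreover have "(exp (- inverse t) * inverse t ^ 2) * inverse t ^ n
        + (of_nat n * inverse t ^ (n - 1) * - (inverse t ^ 2)) * exp (- inverse t)
        = flat_exp (n + 2) t - of_nat n * flat_exp (n + 1) t"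
      using 1 by (cases n) (simp_all add: flat_exp_def algebra_simps power2_eq_square)
    ultimately have "((\<lambda>t. exp (- inverse t) * inverse t ^ n) has_field_derivative
        flat_exp (n + 2) t - of_nat n * flat_exp (n + 1) t) (at t)"
      by metis
    then show ?thesis
      by (rule has_field_derivative_transform_within_open[where S = "{0<..}"])
         (use 1 in \<open>auto simp: flat_exp_def\<close>)
  next
    case 2
    have "((\<lambda>t::real. 0::real) has_field_derivative
        flat_exp (n + 2) t - of_nat n * flat_exp (n + 1) t) (at t)"
      using 2 by (auto intro!: derivative_eq_intros simp: flat_exp_def)
    then show ?thesis
      by (rule has_field_derivative_transform_within_open[where S = "{..<0}"])
         (use 2 in \<open>auto simp: flat_exp_def\<close>)
  next
    case 3
    \<comment> \<open>The difference quotient of \<open>flat_exp n\<close> at 0 is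
      \<open>flat_exp (Suc n)\<close>, so the limit of the next member is the derivative.\<close>
    have "((\<lambda>h. (flat_exp n h - flat_exp n 0) / (h - 0)) \<longlongrightarrow> 0) (at 0)"
      by (rule Lim_transform_eventually[OF flat_exp_tendsto_0[of "Suc n"]])
         (auto simp: eventually_at_filter flat_exp_def field_simps)
    then show ?thesis
      using 3 by (simp add: has_field_derivative_iff flat_exp_def)
  qed
qed

lemma Ck_on_flat_exp: "Ck_on k UNIV (flat_exp n)"
proof (induction k arbitrary: n)
  case 0
  then show ?case
    by (auto intro!: continuous_at_imp_continuous_on DERIV_isCont[OF flat_exp_has_derivative])
next
  case (Suc k)
  have "Ck_on k UNIV (\<lambda>t. flat_exp (n + 2) t + (- of_nat n) * flat_exp (n + 1) t)"
    by (intro Ck_on_add Ck_on_mult Ck_on_const Suc.IH)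
  then have "Ck_on k UNIV (\<lambda>t. flat_exp (n + 2) t - of_nat n * flat_exp (n + 1) t)"
    by simp
  from Ck_on_SucI_real[OF _ this] flat_exp_has_derivative show ?case
    by blast
qed

text \<open>Powers of the reciprocal are closed under differentiation up to constants, which
  replaces a quotient rule; n = 1 serves the denominator of \<open>smooth_step\<close>.\<close>

lemma Ck_on_inverse_power: "Ck_on k {0<..} (\<lambda>x::real. inverse x ^ n)"
proof (induction k arbitrary: n)
  case 0
  then show ?case by (auto intro!: continuous_intros)
next
  case (Suc k)
  have "((\<lambda>x. inverse x ^ n) has_field_derivative - of_nat n * inverse x ^ (n + 1)) (at x within {0<..})"
    if "x \<in> {0<..}" for x :: real
  proof -
    have "(inverse has_field_derivative - (inverse x ^ 2)) (at x within {0<..})"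
      using DERIV_inverse[of x] that by (simp add: power2_eq_square)
    from DERIV_power[OF this, of n] show ?thesis
      by (cases n) (simp_all add: algebra_simps power2_eq_square)
  qed
  from Ck_on_SucI_real[OF this Ck_on_mult[OF Ck_on_const Suc.IH]] show ?case .
qed

lemma flat_exp_pos_sum: "0 < flat_exp 0 (3 * t - 1) + flat_exp 0 (2 - 3 * t)"
proof -
  have "flat_exp 0 x \<ge> 0" "x > 0 \<Longrightarrow> flat_exp 0 x > 0" for x by (auto simp: flat_exp_def)
  moreover have "3 * t - 1 > 0 \<or> 2 - 3 * t > 0" by linarith
  ultimately show ?thesis by (metis add_nonneg_pos add_pos_nonneg)
qed

text \<open>The classical quotient f(3t-1) / (f(3t-1) + f(2-3t)) with f(t) = exp(-1/t). It is
  constant up to 1/3 and from 2/3 on, and these plateaus let paths be joined smoothly. The exponent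
  1 matches \<open>Ck_on_inverse_power\<close>.\<close>

definition smooth_step :: "real \<Rightarrow> real" where
  "smooth_step t = flat_exp 0 (3 * t - 1) * inverse (flat_exp 0 (3 * t - 1) + flat_exp 0 (2 - 3 * t)) ^ 1"

lemma smooth_step_eq_0: "t \<le> 1/3 \<Longrightarrow> smooth_step t = 0"
  by (simp add: smooth_step_def flat_exp_def)

lemma smooth_step_eq_1: "t \<ge> 2/3 \<Longrightarrow> smooth_step t = 1"
  by (simp add: smooth_step_def flat_exp_def)

lemma smooth_step_bounds: "0 \<le> smooth_step t" "smooth_step t \<le> 1"
proof -
  have "flat_exp 0 x \<ge> 0" for x by (auto simp: flat_exp_def)
  then show "0 \<le> smooth_step t" "smooth_step t \<le> 1"
    using flat_exp_pos_sum[of t] by (auto simp: smooth_step_def field_simps)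
qed

lemma Ck_on_smooth_step: "Ck_on k UNIV smooth_step"
proof -
  have l: "Ck_on k UNIV (\<lambda>t. c * t + d)" for c d :: real
    by (intro Ck_on_add Ck_on_const Ck_on_linear bounded_linear_mult_right)
  have a: "Ck_on k UNIV (\<lambda>t. flat_exp 0 (c * t + d))" for c d
    by (rule Ck_on_compose[OF Ck_on_flat_exp l]) simp
  have a1: "Ck_on k UNIV (\<lambda>t. flat_exp 0 (3 * t - 1))" using a[of 3 "-1"] by simp
  have "Ck_on k UNIV (\<lambda>t. flat_exp 0 (2 - 3 * t))" using a[of "-3" 2] by simp
  note s = Ck_on_add[OF a1 this]
  have "Ck_on k UNIV (\<lambda>t. inverse (flat_exp 0 (3 * t - 1) + flat_exp 0 (2 - 3 * t)) ^ 1)"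
    by (rule Ck_on_compose[OF Ck_on_inverse_power s]) (use flat_exp_pos_sum in auto)
  from Ck_on_mult[OF a1 this] show ?thesis unfolding smooth_step_def[abs_def] .
qed

text \<open>The squared distance is smooth at the centre as well. The plateaus of
  \<open>smooth_step\<close> become radii through (1/2)^2 = 1/4 <= 1/3 and (9/10)^2 = 81/100 >= 2/3,
  so the support stays in a closed ball strictly inside the ball of radius r.\<close>

definition bump :: "'v::euclidean_space \<Rightarrow> real \<Rightarrow> 'v \<Rightarrow> real" where
  "bump c r z = 1 - smooth_step ((z - c) \<bullet> (z - c) / r\<^sup>2)"

lemma bump_eq_1:
  assumes "0 < r" "dist c z \<le> r / 2" shows "bump c r z = 1"
proof -
  have "(z - c) \<bullet> (z - c) = (dist c z)\<^sup>2" by (simp add: dist_norm norm_minus_commute flip: power2_norm_eq_inner)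
  also have "\<dots> \<le> (r / 2)\<^sup>2" using assms by (intro power_mono) auto
  also have "\<dots> = 1 / 4 * r\<^sup>2" by (simp add: power2_eq_square)
  also have "\<dots> \<le> 1 / 3 * r\<^sup>2" by (intro mult_right_mono) auto
  finally have "(z - c) \<bullet> (z - c) / r\<^sup>2 \<le> 1 / 3"
    using assms by (simp add: pos_divide_le_eq)
  then show ?thesis by (simp add: bump_def smooth_step_eq_0)
qed

lemma bump_eq_0:
  assumes "0 < r" "dist c z \<ge> 9/10 * r" shows "bump c r z = 0"
proof -
  have "(z - c) \<bullet> (z - c) = (dist c z)\<^sup>2" by (simp add: dist_norm norm_minus_commute flip: power2_norm_eq_inner)
  also have "\<dots> \<ge> (9/10 * r)\<^sup>2" using assms by (intro power_mono) auto
  also have "(9/10 * r)\<^sup>2 = 81/100 * r\<^sup>2" by (simp add: power2_eq_square)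
  also have "\<dots> \<ge> 2/3 * r\<^sup>2" by (intro mult_right_mono) auto
  finally have "(z - c) \<bullet> (z - c) / r\<^sup>2 \<ge> 2/3"
    using assms by (simp add: pos_le_divide_eq)
  then have "smooth_step ((z - c) \<bullet> (z - c) / r\<^sup>2) = 1" by (rule smooth_step_eq_1)
  then show ?thesis by (simp add: bump_def)
qed

lemma Ck_on_bump: "Ck_on k S (bump c r)"
proof -
  have "Ck_on k S (\<lambda>z. z + (- c))" by (intro Ck_on_add Ck_on_const Ck_on_linear bounded_linear_ident)
  then have d: "Ck_on k S (\<lambda>z. z - c)" by simp
  have "Ck_on k S (\<lambda>z. (z - c) \<bullet> (z - c) * inverse (r\<^sup>2))"
    by (intro Ck_on_mult Ck_on_inner Ck_on_const d)
  then have "Ck_on k S (\<lambda>z. smooth_step ((z - c) \<bullet> (z - c) * inverse (r\<^sup>2)))"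
    by (rule Ck_on_compose[OF Ck_on_smooth_step]) simp
  then have "Ck_on k S (\<lambda>z. 1 + (-1) * smooth_step ((z - c) \<bullet> (z - c) * inverse (r\<^sup>2)))"
    by (intro Ck_on_add Ck_on_const Ck_on_mult)
  then show ?thesis by (simp add: bump_def[abs_def] divide_inverse)
qed

section \<open>Uniqueness of derivatives along a set\<close>

definition tangent_projection :: "'v::real_normed_vector set \<Rightarrow> ('v \<Rightarrow> 'v) \<Rightarrow> bool" where
  "tangent_projection S P \<longleftrightarrow> bounded_linear P \<and> (\<forall>x\<in>S. \<forall>y\<in>S. P (y - x) = y - x) \<and>
     (\<forall>x\<in>S. \<forall>v. \<forall>e>0. \<exists>d. d \<noteq> 0 \<and> \<bar>d\<bar> < e \<and> x + d *\<^sub>R P v \<in> S)"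

lemma tangent_projection_openin:
  assumes "tangent_projection S P" "openin (top_of_set S) T"
  shows "tangent_projection T P"
proof -
  have TS: "T \<subseteq> S" using assms(2) openin_imp_subset by blast
  have "\<exists>d. d \<noteq> 0 \<and> \<bar>d\<bar> < e \<and> x + d *\<^sub>R P v \<in> T" if x: "x \<in> T" and e: "e > 0" for x v and e :: real
  proof -
    obtain r where r: "r > 0" "ball x r \<inter> S \<subseteq> T"
      using assms(2) x by (meson openin_contains_ball)
    \<comment> \<open>The second bound keeps the step inside the ball of radius r; adding 1 avoids
      division by zero when \<open>P v\<close> is 0.\<close>
    define e' where "e' = min e (r / (norm (P v) + 1))"
    have "e' > 0" using e r unfolding e'_def
      by (simp add: add_nonneg_pos)
    then obtain d where d: "d \<noteq> 0" "\<bar>d\<bar> < e'" "x + d *\<^sub>R P v \<in> S"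
      using assms(1) x TS unfolding tangent_projection_def by blast
    have "\<bar>d\<bar> * norm (P v) \<le> \<bar>d\<bar> * (norm (P v) + 1)" by (simp add: mult_left_mono)
    also have "\<dots> < r" using d(2) unfolding e'_def by (simp add: pos_less_divide_eq add_nonneg_pos)
    finally have "x + d *\<^sub>R P v \<in> ball x r" by (simp add: dist_norm)
    then show ?thesis using r d unfolding e'_def by auto
  qed
  then show ?thesis using assms(1) TS unfolding tangent_projection_def by blast
qed

text \<open>On the line through x in direction \<open>P v\<close>, 0 is a limit point of the
  admissible parameters, and there uniqueness of vector derivatives in one variable applies.\<close>

lemma tangent_derivative_unique:
  assumes P: "tangent_projection S P" and x: "x \<in> S"
    and D1: "(f has_derivative D1) (at x within S)" and D2: "(f has_derivative D2) (at x within S)"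
  shows "D1 (P v) = D2 (P v)"
proof -
  define T where "T = {d::real. x + d *\<^sub>R P v \<in> S}"
  have "0 islimpt T"
    unfolding islimpt_approachable
  proof (intro allI impI)
    fix e :: real assume "e > 0"
    then obtain d where "d \<noteq> 0 \<and> \<bar>d\<bar> < e \<and> x + d *\<^sub>R P v \<in> S"
      using P x unfolding tangent_projection_def by blast
    then show "\<exists>x'\<in>T. x' \<noteq> 0 \<and> dist x' 0 < e" by (auto simp: T_def intro!: bexI[of _ d])
  qed
  then have nb: "at 0 within T \<noteq> bot" by (simp add: trivial_limit_within)
  have D: "((\<lambda>d. f (x + d *\<^sub>R P v)) has_vector_derivative D (P v)) (at 0 within T)"
    if D: "(f has_derivative D) (at x within S)" for D
  proof -
    have "((\<lambda>d. f (x + d *\<^sub>R P v)) has_derivative (\<lambda>h. D (h *\<^sub>R P v))) (at 0 within T)"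
    proof (rule has_derivative_in_compose[where f = "\<lambda>d. x + d *\<^sub>R P v" and f' = "\<lambda>h. h *\<^sub>R P v" and g = f and g' = D])
      show "((\<lambda>d. x + d *\<^sub>R P v) has_derivative (\<lambda>h. h *\<^sub>R P v)) (at 0 within T)"
        by (auto intro!: derivative_eq_intros)
      have "(\<lambda>d. x + d *\<^sub>R P v) ` T \<subseteq> S" by (auto simp: T_def)
      with D show "(f has_derivative D) (at (x + 0 *\<^sub>R P v) within (\<lambda>d. x + d *\<^sub>R P v) ` T)"
        by (simp add: has_derivative_subset)
    qed
    moreover have "D (h *\<^sub>R P v) = h *\<^sub>R D (P v)" for h
      using D by (simp add: has_derivative_linear linear_cmul)
    ultimately show ?thesis by (simp add: has_vector_derivative_def)
  qed
  show ?thesis by (rule vector_derivative_unique_within[OF nb D[OF D1] D[OF D2]])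
qed

text \<open>The difference quotient evaluates D only at y - x with y in S, and P fixes these
  vectors. Precomposing with P thus normalises a derivative that was arbitrary off the tangent
  directions.\<close>

lemma tangent_derivative:
  assumes P: "tangent_projection S P" and x: "x \<in> S" and D: "(f has_derivative D) (at x within S)"
  shows "(f has_derivative (\<lambda>v. D (P v))) (at x within S)"
proof -
  have "bounded_linear P" using P by (simp add: tangent_projection_def)
  with D have "bounded_linear (\<lambda>v. D (P v))"
    by (metis bounded_linear_compose has_derivative_bounded_linear)
  moreover have "D (P (y - x)) = D (y - x)" if "y \<in> S" for y
    using P x that by (simp add: tangent_projection_def)
  ultimately show ?thesis
    using D unfolding has_derivative_within'
    by (metis (no_types, lifting))
qed

lemma at_within_openin:
  assumes "openin (top_of_set S) T" "x \<in> T"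
  shows "at x within T = at x within S"
proof -
  obtain W where "open W" "T = S \<inter> W" using assms(1) by (auto simp: openin_open)
  with assms(2) show ?thesis by (intro at_within_nhd[of x W]) auto
qed

text \<open>Derivatives chosen on different neighbourhoods may disagree off the tangent directions
  and cannot be glued as they stand. After precomposition with P they agree by
  \<open>tangent_derivative_unique\<close>.\<close>

lemma Ck_on_local:
  fixes f :: "'v::real_normed_vector \<Rightarrow> 'w::real_normed_vector"
  assumes P: "tangent_projection S P"
    and loc: "\<And>x. x \<in> S \<Longrightarrow> \<exists>T. openin (top_of_set S) T \<and> x \<in> T \<and> Ck_on k T f"
  shows "Ck_on k S f"
  using loc
proof (induction k arbitrary: f)
  case 0
  then obtain T where T: "\<And>x. x \<in> S \<Longrightarrow> openin (top_of_set S) (T x) \<and> x \<in> T x \<and> continuous_on (T x) f"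
    unfolding Ck_on.simps by metis
  have "continuous (at x within S) f" if x: "x \<in> S" for x
    using T[OF x] at_within_openin[of S "T x" x] by (metis continuous_on_eq_continuous_within)
  then show ?case by (simp add: continuous_on_eq_continuous_within)
next
  case (Suc k)
  then obtain T where T: "\<And>x. x \<in> S \<Longrightarrow> openin (top_of_set S) (T x) \<and> x \<in> T x \<and> Ck_on (Suc k) (T x) f"
    by metis
  then have "\<forall>x\<in>S. \<exists>f'. (\<forall>y\<in>T x. (f has_derivative f' y) (at y within T x)) \<and> (\<forall>v. Ck_on k (T x) (\<lambda>y. f' y v))"
    unfolding Ck_on.simps by blast
  then obtain F where F: "\<And>x y. x \<in> S \<Longrightarrow> y \<in> T x \<Longrightarrow> (f has_derivative F x y) (at y within T x)"
      "\<And>x v. x \<in> S \<Longrightarrow> Ck_on k (T x) (\<lambda>y. F x y v)"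
    by metis
  have F': "(f has_derivative F x y) (at y within S)" if "x \<in> S" "y \<in> T x" for x y
    using F(1)[OF that] at_within_openin[of S "T x" y] T[OF that(1)] that(2) by metis
  define g where "g y v = F y y (P v)" for y v
  have "(f has_derivative g y) (at y within S)" if "y \<in> S" for y
    unfolding g_def by (rule tangent_derivative[OF P that F']) (use that T in auto)
  moreover have "Ck_on k S (\<lambda>y. g y v)" for v
  proof (rule Suc.IH)
    fix x assume x: "x \<in> S"
    have "Ck_on k (T x) (\<lambda>y. g y v)"
    proof (rule Ck_on_cong[OF F(2)[OF x, of "P v"]])
      fix y assume y: "y \<in> T x"
      then have "y \<in> S" using T[OF x] openin_imp_subset by blast
      then show "F x y (P v) = g y v"
        unfolding g_def using T y x by (intro tangent_derivative_unique[OF P _ F' F']) auto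
    qed
    then show "\<exists>T. openin (top_of_set S) T \<and> x \<in> T \<and> Ck_on k T (\<lambda>y. g y v)" using T[OF x] by blast
  qed
  ultimately show ?case unfolding Ck_on.simps by (intro exI[of _ g]) auto
qed

text \<open>\<open>SOME\<close> may return any derivative; evaluation at \<open>P v\<close> makes
  the value independent of that choice.\<close>

definition dir_deriv :: "'v::real_normed_vector set \<Rightarrow> ('v \<Rightarrow> 'v) \<Rightarrow> ('v \<Rightarrow> 'w::real_normed_vector) \<Rightarrow> 'v \<Rightarrow> 'v \<Rightarrow> 'w" where
  "dir_deriv S P g y v = (SOME D. (g has_derivative D) (at y within S)) (P v)"

lemma dir_deriv_eq:
  assumes "tangent_projection S P" "y \<in> S" "(g has_derivative D) (at y within S)"
  shows "dir_deriv S P g y v = D (P v)"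
  unfolding dir_deriv_def
  by (rule tangent_derivative_unique[OF assms(1,2) _ assms(3)]) (rule someI[of _ D], rule assms(3))

lemma dir_deriv_has_derivative:
  assumes "tangent_projection S P" "y \<in> S" "Ck_on (Suc k) S g"
  shows "(g has_derivative dir_deriv S P g y) (at y within S)"
proof -
  obtain D where D: "(g has_derivative D) (at y within S)"
    using assms(2,3) unfolding Ck_on.simps by blast
  have "dir_deriv S P g y = (\<lambda>v. D (P v))" using dir_deriv_eq[OF assms(1,2) D] by blast
  with tangent_derivative[OF assms(1,2) D] show ?thesis by simp
qed

lemma Ck_on_dir_deriv:
  assumes "tangent_projection S P" "Ck_on (Suc k) S g"
  shows "Ck_on k S (\<lambda>y. dir_deriv S P g y v)"
proof -
  obtain g' where g': "\<forall>x\<in>S. (g has_derivative g' x) (at x within S)" "\<forall>v. Ck_on k S (\<lambda>x. g' x v)"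
    using assms(2) unfolding Ck_on.simps by blast
  have "g' y (P v) = dir_deriv S P g y v" if "y \<in> S" for y
    using dir_deriv_eq[OF assms(1) that bspec[OF g'(1) that]] by simp
  then show ?thesis by (rule Ck_on_cong[OF spec[OF g'(2), of "P v"]])
qed

lemma tangent_projection_unit_interval: "tangent_projection {0..1::real} (\<lambda>v. v)"
proof -
  have "\<exists>d. d \<noteq> 0 \<and> \<bar>d\<bar> < e \<and> x + d * v \<in> {0..1}" if x: "x \<in> {0..1}" and e: "e > 0" for x v e :: real
  proof -
    \<comment> \<open>The step moves x by at most 1/2, so x + d v or x - d v stays in the unit
      interval.\<close>
    define d where "d = min (e / 2) (1 / (2 * (\<bar>v\<bar> + 1)))"
    have d: "d > 0" "d < e" using e by (auto simp: d_def)
    have "d * \<bar>v\<bar> \<le> 1 / (2 * (\<bar>v\<bar> + 1)) * \<bar>v\<bar>" by (intro mult_right_mono) (auto simp: d_def)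
    also have "\<dots> \<le> 1 / 2" by (simp add: field_simps)
    finally have "\<bar>d * v\<bar> \<le> 1 / 2" using d by (simp add: abs_mult)
    then have "x + d * v \<in> {0..1} \<or> x + (- d) * v \<in> {0..1}" using x by (auto simp: abs_if split: if_splits)
    then show ?thesis
    proof
      assume "x + d * v \<in> {0..1}" then show ?thesis using d by (intro exI[of _ d]) auto
    next
      assume "x + (- d) * v \<in> {0..1}" then show ?thesis using d by (intro exI[of _ "- d"]) auto
    qed
  qed
  then show ?thesis unfolding tangent_projection_def real_scaleR_def
    by (intro conjI bounded_linear_ident ballI allI impI) auto
qed

lemma tangent_projection_subspace:
  fixes E :: "'e::euclidean_space set"
  assumes "subspace E"
  shows "\<exists>P. tangent_projection E P \<and> (\<forall>v. P v \<in> E) \<and> (\<forall>v\<in>E. P v = v)"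
proof -
  obtain B where B: "B \<subseteq> E" "pairwise orthogonal B" "\<And>x. x \<in> B \<Longrightarrow> norm x = 1" "independent B" "span B = E"
    using orthonormal_basis_subspace[OF assms] by metis
  have fin: "finite B" using B independent_imp_finite by blast
  define P where "P v = (\<Sum>b\<in>B. (v \<bullet> b) *\<^sub>R b)" for v
  have "bounded_linear P" unfolding P_def
    by (intro bounded_linear_sum bounded_linear_scaleR_const bounded_linear_inner_left)
  moreover have PE: "P v \<in> E" for v
    unfolding P_def using assms B by (intro subspace_sum subspace_scale) auto
  moreover have Pid: "P v = v" if "v \<in> E" for v
    unfolding P_def using orthonormal_basis_expand[OF B(2,3) _ fin] B(5) that by auto
  moreover have "\<exists>d. d \<noteq> 0 \<and> \<bar>d\<bar> < e \<and> x + d *\<^sub>R P v \<in> E" if "x \<in> E" "e > 0" for x v and e :: real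
    using that PE assms by (intro exI[of _ "e / 2"]) (auto intro!: subspace_add subspace_scale)
  moreover have "P (y - x) = y - x" if "x \<in> E" "y \<in> E" for x y
    using Pid assms that by (simp add: subspace_diff)
  ultimately have "tangent_projection E P" unfolding tangent_projection_def by blast
  then show ?thesis using PE Pid by blast
qed

section \<open>Nested integrals\<close>

lemma continuous_on_nested_integral:
  assumes "\<forall>g\<in>set gs. continuous_on {0..1} g"
  shows "continuous_on {0..1} (nested_integral gs)"
  using assms
proof (induction gs)
  case (Cons g gs)
  then have "continuous_on {0..1} (\<lambda>t. nested_integral gs t * g t)"
    by (intro continuous_on_mult) auto
  then have "continuous_on {0..1} (\<lambda>T. integral {0..T} (\<lambda>t. nested_integral gs t * g t))"
    by (intro indefinite_integral_continuous_1 integrable_continuous_interval)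
  then show ?case by simp
qed simp

lemma nested_integral_has_vector_derivative:
  assumes "\<forall>g\<in>set (g # gs). continuous_on {0..1} g" "t \<in> {0..1}"
  shows "(nested_integral (g # gs) has_vector_derivative nested_integral gs t * g t) (at t within {0..1})"
proof -
  have c: "continuous_on {0..1} (\<lambda>t. nested_integral gs t * g t)"
    using assms(1) by (intro continuous_on_mult continuous_on_nested_integral) auto
  have eq: "nested_integral (g # gs) = (\<lambda>T. integral {0..T} (\<lambda>t. nested_integral gs t * g t))"
    by (rule ext) simp
  show ?thesis unfolding eq by (rule integral_has_vector_derivative[OF c assms(2)])
qed

lemma nested_integral_0: "gs \<noteq> [] \<Longrightarrow> nested_integral gs 0 = 0"
  by (cases gs) auto

text \<open>By the fundamental theorem of calculus, a nested integral is determined by its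
  derivative and its value 0 at 0. Product identities for iterated integrals thereby reduce to
  product rules.\<close>

lemma nested_integral_eqI:
  assumes "\<And>t. t \<in> {0..1} \<Longrightarrow> (H has_vector_derivative nested_integral gs t * g t) (at t within {0..1})"
    and "H 0 = 0" and T: "T \<in> {0..1}"
  shows "nested_integral (g # gs) T = H T"
proof -
  have "((\<lambda>t. nested_integral gs t * g t) has_integral H T - H 0) {0..T}"
    by (rule fundamental_theorem_of_calculus)
       (use T in \<open>auto intro!: has_vector_derivative_within_subset[OF assms(1)]\<close>)
  then show ?thesis using assms(2) by (simp add: integral_unique)
qed

text \<open>
  The two functions \<open>\<alpha>\<close> and \<open>\<beta>\<close> are the clocks of the two halves of a concatenated path: \<open>\<beta>\<close> starts
  to run only after \<open>\<alpha>\<close> has arrived at \<open>1\<close>.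
\<close>

lemma nested_integral_concat:
  fixes p r c :: "'i \<Rightarrow> real \<Rightarrow> complex" and \<alpha> \<beta> :: "real \<Rightarrow> real"
  assumes p: "\<forall>w\<in>set ws. continuous_on {0..1} (p w)" and r: "\<forall>w\<in>set ws. continuous_on {0..1} (r w)"
    and \<alpha>: "\<And>t. t \<in> {0..1} \<Longrightarrow> (\<alpha> has_vector_derivative \<alpha>' t) (at t within {0..1})" "\<alpha> ` {0..1} \<subseteq> {0..1}" "\<alpha> 0 = 0"
    and \<beta>: "\<And>t. t \<in> {0..1} \<Longrightarrow> (\<beta> has_vector_derivative \<beta>' t) (at t within {0..1})" "\<beta> ` {0..1} \<subseteq> {0..1}" "\<beta> 0 = 0"
    and z: "\<And>t. t \<in> {0..1} \<Longrightarrow> \<alpha>' t \<noteq> 0 \<Longrightarrow> \<beta> t = 0" "\<And>t. t \<in> {0..1} \<Longrightarrow> \<beta>' t \<noteq> 0 \<Longrightarrow> \<alpha>' t = 0"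
    and c: "\<And>w t. w \<in> set ws \<Longrightarrow> t \<in> {0..1} \<Longrightarrow> c w t = \<alpha>' t *\<^sub>R p w (\<alpha> t) + \<beta>' t *\<^sub>R r w (\<beta> t)"
    and T: "T \<in> {0..1}"
  shows "nested_integral (map c ws) T =
    (\<Sum>k\<le>length ws. nested_integral (map r (take k ws)) (\<beta> T) * nested_integral (map p (drop k ws)) (\<alpha> T))"
  using p r c T
proof (induction ws arbitrary: T)
  case Nil
  then show ?case by simp
next
  case (Cons w ws)
  \<comment> \<open>The head of a list is integrated last and so sees the latest times; hence
    initial segments of the list belong to the second half r and the remainders to the first half
    p.\<close>
  define R where "R us t = nested_integral (map r us) (\<beta> t)" for us t
  define Q where "Q us t = nested_integral (map p us) (\<alpha> t)" for us t
  define S where "S us t = (\<Sum>k\<le>length us. R (take k us) t * Q (drop k us) t)" for us t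
  have IH: "nested_integral (map c ws) t = S ws t" if "t \<in> {0..1}" for t
    unfolding S_def R_def Q_def using Cons.prems that by (intro Cons.IH) auto
  have dR: "(R (u # us) has_vector_derivative \<beta>' t *\<^sub>R (R us t * r u (\<beta> t))) (at t within {0..1})"
    if "set (u # us) \<subseteq> set (w # ws)" "t \<in> {0..1}" for u us t
  proof -
    have "(nested_integral (map r (u # us)) has_vector_derivative R us t * r u (\<beta> t)) (at (\<beta> t) within {0..1})"
      unfolding R_def list.map
    proof (rule nested_integral_has_vector_derivative)
      show "\<forall>g\<in>set (r u # map r us). continuous_on {0..1} g" using Cons.prems(2) that by auto
    qed (use \<beta>(2) that in blast)
    from vector_diff_chain_within[OF \<beta>(1)[OF that(2)] has_vector_derivative_within_subset[OF this \<beta>(2)]]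
    show ?thesis by (simp add: o_def R_def[abs_def] del: nested_integral.simps)
  qed
  have dQ: "(Q (u # us) has_vector_derivative \<alpha>' t *\<^sub>R (Q us t * p u (\<alpha> t))) (at t within {0..1})"
    if "set (u # us) \<subseteq> set (w # ws)" "t \<in> {0..1}" for u us t
  proof -
    have "(nested_integral (map p (u # us)) has_vector_derivative Q us t * p u (\<alpha> t)) (at (\<alpha> t) within {0..1})"
      unfolding Q_def list.map
    proof (rule nested_integral_has_vector_derivative)
      show "\<forall>g\<in>set (p u # map p us). continuous_on {0..1} g" using Cons.prems(1) that by auto
    qed (use \<alpha>(2) that in blast)
    from vector_diff_chain_within[OF \<alpha>(1)[OF that(2)] has_vector_derivative_within_subset[OF this \<alpha>(2)]]
    show ?thesis by (simp add: o_def Q_def[abs_def] del: nested_integral.simps)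
  qed
  \<comment> \<open>The derivative of \<open>Q us\<close> is recorded merely as a multiple of
    \<open>\<alpha>' t\<close>, which covers the empty list too. Its exact value drops out later:
    either \<open>\<alpha>' t\<close> is 0 or the accompanying factor R vanishes.\<close>
  have Q1: "\<exists>d. (Q us has_vector_derivative \<alpha>' t *\<^sub>R d) (at t within {0..1})"
    if "set us \<subseteq> set (w # ws)" "t \<in> {0..1}" for us t
  proof (cases us)
    case Nil
    then show ?thesis by (intro exI[of _ 0]) (simp add: Q_def[abs_def] has_vector_derivative_const)
  next
    case (Cons u us')
    then show ?thesis using dQ that by blast
  qed
  have R0: "R us t = 0" if "us \<noteq> []" "\<beta> t = 0" for us t
    using that by (simp add: R_def nested_integral_0)
  \<comment> \<open>The term k = 0 is split off because it alone has w in the factor Q; in all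
    others w heads the factor R.\<close>
  have S_Cons: "S (w # ws) t = Q (w # ws) t + (\<Sum>k\<le>length ws. R (w # take k ws) t * Q (drop k ws) t)" for t
    unfolding S_def by (simp add: sum.atMost_Suc_shift del: sum.atMost_Suc) (simp add: R_def)
  have S0: "S ws t = Q ws t" if "\<beta> t = 0" for t
  proof -
    have "S ws t = (\<Sum>k\<in>{0}. R (take k ws) t * Q (drop k ws) t)"
      unfolding S_def
    proof (rule sum.mono_neutral_right)
      show "\<forall>k\<in>{..length ws} - {0}. R (take k ws) t * Q (drop k ws) t = 0"
      proof
        fix k assume "k \<in> {..length ws} - {0}"
        then have "take k ws \<noteq> []" by auto
        with R0 that show "R (take k ws) t * Q (drop k ws) t = 0" by simp
      qed
    qed auto
    then show ?thesis by (simp add: R_def)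
  qed
  have "nested_integral (c w # map c ws) T = S (w # ws) T"
  proof (rule nested_integral_eqI)
    fix t :: real assume t: "t \<in> {0..1}"
    have "\<forall>k. \<exists>d. (Q (drop k ws) has_vector_derivative \<alpha>' t *\<^sub>R d) (at t within {0..1})"
      using Q1 t by (metis set_drop_subset set_subset_Cons subset_trans)
    then obtain D where D: "\<And>k. (Q (drop k ws) has_vector_derivative \<alpha>' t *\<^sub>R D k) (at t within {0..1})"
      by metis
    have RD: "(R (w # take k ws) has_vector_derivative \<beta>' t *\<^sub>R (R (take k ws) t * r w (\<beta> t))) (at t within {0..1})"
      for k by (rule dR) (use t set_take_subset in fastforce)+
    have "(S (w # ws) has_vector_derivative \<alpha>' t *\<^sub>R (Q ws t * p w (\<alpha> t)) +
      (\<Sum>k\<le>length ws. R (w # take k ws) t * (\<alpha>' t *\<^sub>R D k) +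
         (\<beta>' t *\<^sub>R (R (take k ws) t * r w (\<beta> t))) * Q (drop k ws) t)) (at t within {0..1})"
      unfolding S_Cons[abs_def]
      by (intro has_vector_derivative_add dQ has_vector_derivative_sum has_vector_derivative_mult D RD t) simp
    also have "\<alpha>' t *\<^sub>R (Q ws t * p w (\<alpha> t)) +
      (\<Sum>k\<le>length ws. R (w # take k ws) t * (\<alpha>' t *\<^sub>R D k) +
         (\<beta>' t *\<^sub>R (R (take k ws) t * r w (\<beta> t))) * Q (drop k ws) t) =
      nested_integral (map c ws) t * c w t"
    \<comment> \<open>Only one clock runs at a time. If \<open>\<alpha>' t = 0\<close>, the
      surviving terms reassemble to \<open>S ws t\<close> times the r-part of \<open>c w t\<close>;
      otherwise \<open>\<beta>\<close> is still 0, every R of a nonempty list vanishes, and only the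
      p-part remains.\<close>
    proof (cases "\<alpha>' t = 0")
      case True
      then show ?thesis
        using Cons.prems(3)[of w t] t by (simp add: IH S_def sum_distrib_left sum_distrib_right mult_ac)
    next
      case False
      then have b: "\<beta> t = 0" "\<beta>' t = 0" using z t by blast+
      then show ?thesis
        using Cons.prems(3)[of w t] t by (simp add: IH S0 R0 mult_ac)
    qed
    finally show "(S (w # ws) has_vector_derivative nested_integral (map c ws) t * c w t) (at t within {0..1})" .
  next
    have "R (w # take k ws) 0 = 0" for k using \<beta>(3) by (simp add: R0)
    then show "S (w # ws) 0 = 0"
      unfolding S_Cons using \<alpha>(3) by (simp add: Q_def)
  qed (use Cons.prems in auto)
  then show ?case by (simp add: S_def R_def Q_def)
qed

text \<open>The product rule yields two terms, and H isolates the one that contains a'. The boundary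
  term at 0 vanishes because the list is nonempty; the empty word is served by
  \<open>nested_integral_single\<close> instead.\<close>

lemma nested_integral_by_parts:
  fixes a a' :: "real \<Rightarrow> complex"
  assumes a: "\<And>t. t \<in> {0..1} \<Longrightarrow> (a has_vector_derivative a' t) (at t within {0..1})"
    and g: "\<forall>f\<in>set (g # gs). continuous_on {0..1} f" and T: "T \<in> {0..1}"
  shows "a T * nested_integral (g # gs) T =
    nested_integral (a' # g # gs) T + nested_integral ((\<lambda>t. a t * g t) # gs) T"
proof -
  define K where "K = nested_integral ((\<lambda>t. a t * g t) # gs)"
  define H where "H t = a t * nested_integral (g # gs) t - K t" for t
  have ca: "continuous_on {0..1} a"
    using a by (meson continuous_on_eq_continuous_within has_vector_derivative_continuous)
  have "nested_integral (a' # g # gs) T = H T"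
  proof (rule nested_integral_eqI)
    fix t :: real assume t: "t \<in> {0..1}"
    have "(K has_vector_derivative nested_integral gs t * (a t * g t)) (at t within {0..1})"
      unfolding K_def using g t by (intro nested_integral_has_vector_derivative) (auto intro!: continuous_on_mult ca)
    from has_vector_derivative_diff[OF has_vector_derivative_mult[OF a[OF t] nested_integral_has_vector_derivative[OF g t]] this]
    show "(H has_vector_derivative nested_integral (g # gs) t * a' t) (at t within {0..1})"
      unfolding H_def[abs_def] by (simp add: mult_ac)
  qed (use T in \<open>auto simp: H_def K_def nested_integral_0\<close>)
  then show ?thesis by (simp add: H_def K_def)
qed

lemma nested_integral_single:
  assumes "\<And>t. t \<in> {0..1} \<Longrightarrow> (a has_vector_derivative a' t) (at t within {0..1})" "T \<in> {0..1}"
  shows "nested_integral [a'] T = a T - a 0"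
  by (rule nested_integral_eqI) (use assms in \<open>auto intro!: derivative_eq_intros\<close>)

section \<open>Nested integrals depending smoothly on a parameter\<close>

lemma integral_scale_unit:
  fixes h :: "real \<Rightarrow> complex"
  assumes h: "continuous_on {0..1} h" and T: "T \<in> {0..1}"
  shows "integral {0..T} h = integral {0..1} (\<lambda>u. T *\<^sub>R h (T * u))"
proof -
  define K where "K t = integral {0..t} h" for t
  have "((\<lambda>u. T *\<^sub>R h (T * u)) has_integral (K \<circ> (\<lambda>u. T * u)) 1 - (K \<circ> (\<lambda>u. T * u)) 0) {0..1}"
  proof (rule fundamental_theorem_of_calculus)
    fix u :: real assume u: "u \<in> {0..1}"
    have im: "(\<lambda>u. T * u) ` {0..1} \<subseteq> {0..1}" using T by (auto intro!: mult_nonneg_nonneg mult_le_one)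
    have "(K has_vector_derivative h (T * u)) (at (T * u) within {0..1})"
      unfolding K_def by (rule integral_has_vector_derivative[OF h]) (use u im in blast)
    then show "(K \<circ> (\<lambda>u. T * u) has_vector_derivative T *\<^sub>R h (T * u)) (at u within {0..1})"
      by (intro vector_diff_chain_within has_vector_derivative_within_subset[OF _ im])
         (auto intro!: derivative_eq_intros)
  qed simp
  then have "((\<lambda>u. T *\<^sub>R h (T * u)) has_integral integral {0..T} h) {0..1}"
    by (simp add: K_def)
  from integral_unique[OF this] show ?thesis by (rule sym)
qed

text \<open>The upper limit is treated as a variable alongside the parameter, because inner
  integrals are evaluated at varying times. \<open>integral_scale_unit\<close> moves it into the
  integrand, so that \<open>Ck_on_integral\<close> with its fixed limits applies over
  \<open>S \<times> {0..1}\<close>, which is again convex.\<close>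

lemma Ck_on_nested_integral:
  fixes f :: "'i \<Rightarrow> 'u::euclidean_space \<Rightarrow> real \<Rightarrow> complex"
  assumes "convex S" "\<forall>w\<in>set ws. Ck_on k (S \<times> {0..1}) (\<lambda>z. f w (fst z) (snd z))"
  shows "Ck_on k (S \<times> {0..1}) (\<lambda>z. nested_integral (map (\<lambda>w. f w (fst z)) ws) (snd z))"
  using assms(2)
proof (induction ws)
  case Nil
  then show ?case by (simp add: Ck_on_const)
next
  case (Cons w ws)
  define h where "h z = nested_integral (map (\<lambda>w. f w (fst z)) ws) (snd z) * f w (fst z) (snd z)" for z
  have hk: "Ck_on k (S \<times> {0..1}) h"
    unfolding h_def using Cons by (intro Ck_on_mult) auto
  have bf: "bounded_linear (\<lambda>z :: ('u \<times> real) \<times> real. fst (fst z))"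
    and bs: "bounded_linear (\<lambda>z :: ('u \<times> real) \<times> real. snd (fst z))"
    by (rule bounded_linear_compose[OF bounded_linear_fst bounded_linear_fst],
        rule bounded_linear_compose[OF bounded_linear_snd bounded_linear_fst])
  have "Ck_on k ((S \<times> {0..1}) \<times> {0..1}) (\<lambda>z. snd (fst z) *\<^sub>R h (fst (fst z), snd (fst z) * snd z))"
  proof (intro Ck_on_scaleR Ck_on_compose[OF hk] Ck_on_Pair Ck_on_mult Ck_on_linear bf bs bounded_linear_snd)
    show "(\<lambda>z. (fst (fst z), snd (fst z) * snd z)) ` ((S \<times> {0..1}) \<times> {0..1}) \<subseteq> S \<times> {0..1::real}"
      by (auto intro!: mult_nonneg_nonneg mult_le_one)
  qed
  then have "Ck_on k (S \<times> {0..1}) (\<lambda>z. integral {0..1} (\<lambda>u. snd z *\<^sub>R h (fst z, snd z * u)))"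
    by (intro Ck_on_integral convex_Times assms(1)) (auto simp: convex_real_interval)
  then show ?case
  proof (rule Ck_on_cong)
    fix z :: "'u \<times> real" assume z: "z \<in> S \<times> {0..1}"
    have "continuous_on {0..1} (\<lambda>t. h (fst z, t))"
      by (rule continuous_on_compose2[OF Ck_on_imp_continuous_on[OF hk]])
         (use z in \<open>auto intro!: continuous_intros\<close>)
    from integral_scale_unit[OF this, of "snd z"] z
    show "integral {0..1} (\<lambda>u. snd z *\<^sub>R h (fst z, snd z * u)) =
        nested_integral (map (\<lambda>w. f w (fst z)) (w # ws)) (snd z)"
      by (auto simp: h_def)
  qed
qed

section \<open>Smooth functions and forms on a manifold\<close>

text \<open>P is bundled as a fixed projection onto the model space E, because derivatives are
  determined and form coefficients are known to be smooth along E alone. The final proof supplies it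
  from \<open>tangent_projection_subspace\<close>.\<close>

locale projected_manifold =
  fixes E :: "'e::euclidean_space set"
    and X :: "'a::{t2_space, second_countable_topology} set"
    and A :: "('a, 'e) chart set"
    and P :: "'e \<Rightarrow> 'e"
  assumes manifold: "smooth_manifold E X A"
    and tangent: "tangent_projection E P"
    and P_in: "P v \<in> E"
    and P_id: "v \<in> E \<Longrightarrow> P v = v"
begin

lemma subspace_E: "subspace E"
  using manifold by (simp add: smooth_manifold_def)

lemma chart_cover: "m \<in> X \<Longrightarrow> \<exists>U \<phi>. (U, \<phi>) \<in> A \<and> m \<in> U"
  using manifold unfolding smooth_manifold_def by blast

lemma chart:
  assumes "(U, \<phi>) \<in> A"
  shows "openin (top_of_set X) U" "openin (top_of_set E) (\<phi> ` U)"
    "homeomorphism U (\<phi> ` U) \<phi> (inv_into U \<phi>)" "U \<subseteq> X" "\<phi> ` U \<subseteq> E" "inj_on \<phi> U"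
proof -
  show o: "openin (top_of_set X) U" "openin (top_of_set E) (\<phi> ` U)"
    and h: "homeomorphism U (\<phi> ` U) \<phi> (inv_into U \<phi>)"
    using manifold assms unfolding smooth_manifold_def by blast+
  show "U \<subseteq> X" "\<phi> ` U \<subseteq> E" using o openin_imp_subset by blast+
  show "inj_on \<phi> U" using h unfolding homeomorphism_def by (intro inj_on_inverseI[where g = "inv_into U \<phi>"]) blast
qed

lemma chart_inv:
  assumes "(U, \<phi>) \<in> A" "m \<in> U"
  shows "inv_into U \<phi> (\<phi> m) = m"
  using chart(6)[OF assms(1)] assms(2) by (rule inv_into_f_f)

lemma transition_smooth:
  assumes "(U, \<phi>) \<in> A" "(W, \<psi>) \<in> A"
  shows "Ck_on k (\<phi> ` (U \<inter> W)) (\<lambda>y. \<psi> (inv_into U \<phi> y))"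
proof -
  have "smooth_on (\<phi> ` (U \<inter> W)) (\<psi> \<circ> inv_into U \<phi>)"
    using manifold assms unfolding smooth_manifold_def by blast
  then show ?thesis by (simp add: smooth_on_def o_def)
qed

lemma openin_chart_image:
  assumes "(U, \<phi>) \<in> A" "openin (top_of_set X) N"
  shows "openin (top_of_set E) (\<phi> ` (U \<inter> N))"
proof -
  have "openin (top_of_set U) (U \<inter> N)"
    by (rule openin_subset_trans[OF openin_Int[OF chart(1)[OF assms(1)] assms(2)]])
       (use chart(4)[OF assms(1)] in auto)
  from homeomorphism_imp_open_map[OF chart(3)[OF assms(1)] this]
  show ?thesis using chart(2)[OF assms(1)] openin_trans by blast
qed

lemma tangent_openin: "openin (top_of_set E) S \<Longrightarrow> tangent_projection S P"
  by (rule tangent_projection_openin[OF tangent])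

definition smooth_fun :: "('a \<Rightarrow> complex) \<Rightarrow> bool" where
  "smooth_fun a \<longleftrightarrow> (\<forall>(U, \<phi>)\<in>A. \<forall>k. Ck_on k (\<phi> ` U) (\<lambda>y. a (inv_into U \<phi> y)))"

lemma smooth_funD: "smooth_fun a \<Longrightarrow> (U, \<phi>) \<in> A \<Longrightarrow> Ck_on k (\<phi> ` U) (\<lambda>y. a (inv_into U \<phi> y))"
  unfolding smooth_fun_def by blast

text \<open>Transition maps carry smoothness from the chart W to every other chart, and
  \<open>Ck_on_local\<close> glues the neighbourhoods. One convenient chart near each point is
  therefore enough.\<close>

lemma smooth_funI_local:
  assumes "\<And>m. m \<in> X \<Longrightarrow> \<exists>W \<psi> N. (W, \<psi>) \<in> A \<and> openin (top_of_set X) N \<and> m \<in> N \<and> N \<subseteq> W \<and>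
    (\<forall>k. Ck_on k (\<psi> ` N) (\<lambda>y. a (inv_into W \<psi> y)))"
  shows "smooth_fun a"
  unfolding smooth_fun_def
proof (intro ballI, clarify)
  fix U \<phi> k assume c: "(U, \<phi>) \<in> A"
  show "Ck_on k (\<phi> ` U) (\<lambda>y. a (inv_into U \<phi> y))"
  proof (rule Ck_on_local[OF tangent_openin[OF chart(2)[OF c]]])
    fix y assume "y \<in> \<phi> ` U"
    then obtain m where m: "m \<in> U" "y = \<phi> m" by blast
    then have "m \<in> X" using chart(4)[OF c] by blast
    from assms[OF this] obtain W \<psi> N where N: "(W, \<psi>) \<in> A" "openin (top_of_set X) N" "m \<in> N" "N \<subseteq> W"
      "\<And>k. Ck_on k (\<psi> ` N) (\<lambda>y. a (inv_into W \<psi> y))" by blast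
    have "openin (top_of_set (\<phi> ` U)) (\<phi> ` (U \<inter> N))"
      by (rule openin_subset_trans[OF openin_chart_image[OF c N(2)]]) (use chart(5)[OF c] in auto)
    moreover have "Ck_on k (\<phi> ` (U \<inter> N)) (\<lambda>y. a (inv_into U \<phi> y))"
    proof (rule Ck_on_cong)
      show "Ck_on k (\<phi> ` (U \<inter> N)) (\<lambda>y. a (inv_into W \<psi> (\<psi> (inv_into U \<phi> y))))"
        by (rule Ck_on_compose[OF N(5) Ck_on_subset[OF transition_smooth[OF c N(1)]]])
           (use N(4) chart_inv[OF c] in auto)
      show "a (inv_into W \<psi> (\<psi> (inv_into U \<phi> y))) = a (inv_into U \<phi> y)" if "y \<in> \<phi> ` (U \<inter> N)" for y
        using that N(4) chart_inv[OF c] chart_inv[OF N(1)] by auto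
    qed
    ultimately show "\<exists>T. openin (top_of_set (\<phi> ` U)) T \<and> y \<in> T \<and> Ck_on k T (\<lambda>y. a (inv_into U \<phi> y))"
      using m N(3) by blast
  qed
qed

lemma smooth_fun_locally_eq:
  assumes "\<And>m. m \<in> X \<Longrightarrow> \<exists>N b. openin (top_of_set X) N \<and> m \<in> N \<and> smooth_fun b \<and> (\<forall>m\<in>N. a m = b m)"
  shows "smooth_fun a"
proof (rule smooth_funI_local)
  fix m assume m: "m \<in> X"
  obtain N b where N: "openin (top_of_set X) N" "m \<in> N" "smooth_fun b" "\<forall>m\<in>N. a m = b m"
    using assms[OF m] by blast
  obtain W \<psi> where W: "(W, \<psi>) \<in> A" "m \<in> W" using chart_cover[OF m] by blast
  have "Ck_on k (\<psi> ` (W \<inter> N)) (\<lambda>y. a (inv_into W \<psi> y))" for k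
    by (rule Ck_on_cong[OF Ck_on_subset[OF smooth_funD[OF N(3) W(1)]]])
       (use N(4) chart_inv[OF W(1)] in auto)
  moreover have "openin (top_of_set X) (W \<inter> N)" using N(1) chart(1)[OF W(1)] by blast
  ultimately show "\<exists>W \<psi> N. (W, \<psi>) \<in> A \<and> openin (top_of_set X) N \<and> m \<in> N \<and> N \<subseteq> W \<and>
    (\<forall>k. Ck_on k (\<psi> ` N) (\<lambda>y. a (inv_into W \<psi> y)))"
    using W N(2) by (intro exI[of _ W] exI[of _ \<psi>] exI[of _ "W \<inter> N"]) auto
qed

lemma smooth_fun_const: "smooth_fun (\<lambda>m. c)"
  unfolding smooth_fun_def using Ck_on_const by blast

lemma smooth_fun_add: "smooth_fun a \<Longrightarrow> smooth_fun b \<Longrightarrow> smooth_fun (\<lambda>m. a m + b m)"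
  unfolding smooth_fun_def using Ck_on_add by blast

lemma smooth_fun_mult: "smooth_fun a \<Longrightarrow> smooth_fun b \<Longrightarrow> smooth_fun (\<lambda>m. a m * b m)"
  unfolding smooth_fun_def using Ck_on_mult by blast

lemma smooth_fun_diff: "smooth_fun a \<Longrightarrow> smooth_fun b \<Longrightarrow> smooth_fun (\<lambda>m. a m - b m)"
  using smooth_fun_add[OF _ smooth_fun_mult[OF smooth_fun_const[of "-1"]], of a b] by simp

lemma smooth_fun_sum: "(\<And>i. i \<in> I \<Longrightarrow> smooth_fun (a i)) \<Longrightarrow> smooth_fun (\<lambda>m. \<Sum>i\<in>I. a i m)"
  by (induction I rule: infinite_finite_induct) (auto intro: smooth_fun_const smooth_fun_add)

lemma smooth_fun_prod: "(\<And>i. i \<in> I \<Longrightarrow> smooth_fun (a i)) \<Longrightarrow> smooth_fun (\<lambda>m. \<Prod>i\<in>I. a i m)"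
  by (induction I rule: infinite_finite_induct) (auto intro: smooth_fun_const smooth_fun_mult)

section \<open>The exterior derivative and operations on smooth forms\<close>

definition exterior_derivative :: "('a \<Rightarrow> complex) \<Rightarrow> ('a, 'e) form" where
  "exterior_derivative a = (\<lambda>(U, \<phi>) m. dir_deriv (\<phi> ` U) P (\<lambda>y. a (inv_into U \<phi> y)) (\<phi> m))"

lemma exterior_derivative_has_derivative:
  assumes "smooth_fun a" "(U, \<phi>) \<in> A" "m \<in> U"
  shows "((\<lambda>y. a (inv_into U \<phi> y)) has_derivative exterior_derivative a (U, \<phi>) m) (at (\<phi> m) within \<phi> ` U)"
  unfolding exterior_derivative_def prod.case
  using assms(3) by (intro dir_deriv_has_derivative[where k = 0] tangent_openin chart(2) smooth_funD assms(1,2)) auto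

lemma exterior_derivative_smooth_form:
  assumes a: "smooth_fun a"
  shows "exterior_derivative a \<in> smooth_forms E A"
  unfolding smooth_forms_def
proof (intro CollectI conjI)
  show "\<forall>(U, \<phi>)\<in>A. \<forall>m\<in>U. linear (exterior_derivative a (U, \<phi>) m)"
    using exterior_derivative_has_derivative[OF a] has_derivative_linear by fast
  show "\<forall>(U, \<phi>)\<in>A. \<forall>(W, \<psi>)\<in>A. \<forall>m\<in>U \<inter> W. \<forall>D.
        ((\<psi> \<circ> inv_into U \<phi>) has_derivative D) (at (\<phi> m) within \<phi> ` (U \<inter> W)) \<longrightarrow>
        (\<forall>v\<in>E. exterior_derivative a (U, \<phi>) m v = exterior_derivative a (W, \<psi>) m (D v))"
  proof (clarify, unfold o_def)
    fix U \<phi> W \<psi> m D v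
    assume c: "(U, \<phi>) \<in> A" "(W, \<psi>) \<in> A" and m: "m \<in> U" "m \<in> W" and v: "v \<in> E"
      and D: "((\<lambda>y. \<psi> (inv_into U \<phi> y)) has_derivative D) (at (\<phi> m) within \<phi> ` (U \<inter> W))"
    have im: "(\<lambda>y. \<psi> (inv_into U \<phi> y)) ` \<phi> ` (U \<inter> W) \<subseteq> \<psi> ` W" using chart_inv[OF c(1)] by auto
    have 1: "((\<lambda>y. a (inv_into U \<phi> y)) has_derivative exterior_derivative a (U, \<phi>) m) (at (\<phi> m) within \<phi> ` (U \<inter> W))"
      by (rule has_derivative_subset[OF exterior_derivative_has_derivative[OF a c(1) m(1)]]) auto
    have "((\<lambda>y. a (inv_into W \<psi> (\<psi> (inv_into U \<phi> y)))) has_derivative (\<lambda>v. exterior_derivative a (W, \<psi>) m (D v)))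
        (at (\<phi> m) within \<phi> ` (U \<inter> W))"
      by (rule has_derivative_in_compose[OF D])
         (use has_derivative_subset[OF exterior_derivative_has_derivative[OF a c(2) m(2)] im] chart_inv[OF c(1) m(1)] in simp)
    then have 2: "((\<lambda>y. a (inv_into U \<phi> y)) has_derivative (\<lambda>v. exterior_derivative a (W, \<psi>) m (D v)))
        (at (\<phi> m) within \<phi> ` (U \<inter> W))"
      by (rule has_derivative_transform[rotated 2]) (use m chart_inv[OF c(1)] chart_inv[OF c(2)] in auto)
    \<comment> \<open>Both maps are derivatives of the same coordinate function on a relatively open
      subset of E, hence equal along E; v lies in E and is fixed by P.\<close>
    have "exterior_derivative a (U, \<phi>) m (P v) = exterior_derivative a (W, \<psi>) m (D (P v))"
      by (rule tangent_derivative_unique[OF tangent_openin[OF openin_chart_image[OF c(1) chart(1)[OF c(2)]]] _ 1 2])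
         (use m in auto)
    then show "exterior_derivative a (U, \<phi>) m v = exterior_derivative a (W, \<psi>) m (D v)"
      using P_id[OF v] by simp
  qed
  show "\<forall>(U, \<phi>)\<in>A. \<forall>v\<in>E. smooth_on (\<phi> ` U) (\<lambda>y. exterior_derivative a (U, \<phi>) (inv_into U \<phi> y) v)"
    unfolding smooth_on_def
  proof clarify
    fix U \<phi> v k assume c: "(U, \<phi>) \<in> A"
    show "Ck_on k (\<phi> ` U) (\<lambda>y. exterior_derivative a (U, \<phi>) (inv_into U \<phi> y) v)"
      by (rule Ck_on_cong[OF Ck_on_dir_deriv[OF tangent_openin[OF chart(2)[OF c]] smooth_funD[OF a c]]])
         (auto simp: exterior_derivative_def chart_inv[OF c])
  qed
qed

lemma smooth_form_linear: "\<omega> \<in> smooth_forms E A \<Longrightarrow> (U, \<phi>) \<in> A \<Longrightarrow> m \<in> U \<Longrightarrow> linear (\<omega> (U, \<phi>) m)"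
  unfolding smooth_forms_def by blast

lemma smooth_form_transform:
  assumes "\<omega> \<in> smooth_forms E A" "(U, \<phi>) \<in> A" "(W, \<psi>) \<in> A" "m \<in> U" "m \<in> W" "v \<in> E"
    and "((\<lambda>y. \<psi> (inv_into U \<phi> y)) has_derivative D) (at (\<phi> m) within \<phi> ` (U \<inter> W))"
  shows "\<omega> (U, \<phi>) m v = \<omega> (W, \<psi>) m (D v)"
proof -
  have "\<forall>m\<in>U \<inter> W. \<forall>D. ((\<psi> \<circ> inv_into U \<phi>) has_derivative D) (at (\<phi> m) within \<phi> ` (U \<inter> W)) \<longrightarrow>
        (\<forall>v\<in>E. \<omega> (U, \<phi>) m v = \<omega> (W, \<psi>) m (D v))"
    using assms(1-3) unfolding smooth_forms_def by blast
  then show ?thesis using assms(4-7) by (simp add: o_def)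
qed

lemma smooth_form_Ck_on:
  "\<omega> \<in> smooth_forms E A \<Longrightarrow> (U, \<phi>) \<in> A \<Longrightarrow> v \<in> E \<Longrightarrow> Ck_on k (\<phi> ` U) (\<lambda>y. \<omega> (U, \<phi>) (inv_into U \<phi> y) v)"
  unfolding smooth_forms_def smooth_on_def by blast

text \<open>The coefficients are taken at \<open>P b\<close> rather than b because smoothness of a
  form is known only in directions of E.\<close>

lemma smooth_form_expand:
  assumes "\<omega> \<in> smooth_forms E A" "(U, \<phi>) \<in> A" "m \<in> U" "v \<in> E"
  shows "\<omega> (U, \<phi>) m v = (\<Sum>b\<in>Basis. (v \<bullet> b) *\<^sub>R \<omega> (U, \<phi>) m (P b))"
proof -
  have P: "linear P" using tangent by (simp add: tangent_projection_def bounded_linear.linear)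
  have "linear (\<lambda>v. \<omega> (U, \<phi>) m (P v))"
    using linear_compose[OF P smooth_form_linear[OF assms(1-3)]] by (simp add: o_def)
  from linear_Basis_expand[OF this, of v] show ?thesis using P_id[OF assms(4)] by simp
qed

definition form_scale :: "('a \<Rightarrow> complex) \<Rightarrow> ('a, 'e) form \<Rightarrow> ('a, 'e) form" where
  "form_scale a \<omega> = (\<lambda>c m v. a m * \<omega> c m v)"

lemma form_scale_smooth_form:
  assumes "smooth_fun a" "\<omega> \<in> smooth_forms E A"
  shows "form_scale a \<omega> \<in> smooth_forms E A"
  unfolding smooth_forms_def
proof (intro CollectI conjI)
  show "\<forall>(U, \<phi>)\<in>A. \<forall>m\<in>U. linear (form_scale a \<omega> (U, \<phi>) m)"
  proof clarify
    fix U \<phi> m assume "(U, \<phi>) \<in> A" "m \<in> U"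
    from smooth_form_linear[OF assms(2) this] show "linear (form_scale a \<omega> (U, \<phi>) m)"
      unfolding form_scale_def by (simp add: linear_iff algebra_simps)
  qed
  show "\<forall>(U, \<phi>)\<in>A. \<forall>(W, \<psi>)\<in>A. \<forall>m\<in>U \<inter> W. \<forall>D.
        ((\<psi> \<circ> inv_into U \<phi>) has_derivative D) (at (\<phi> m) within \<phi> ` (U \<inter> W)) \<longrightarrow>
        (\<forall>v\<in>E. form_scale a \<omega> (U, \<phi>) m v = form_scale a \<omega> (W, \<psi>) m (D v))"
  proof (clarify, unfold o_def)
    fix U \<phi> W \<psi> m D v
    assume "(U, \<phi>) \<in> A" "(W, \<psi>) \<in> A" "m \<in> U" "m \<in> W" "v \<in> E"
      "((\<lambda>y. \<psi> (inv_into U \<phi> y)) has_derivative D) (at (\<phi> m) within \<phi> ` (U \<inter> W))"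
    from smooth_form_transform[OF assms(2) this]
    show "form_scale a \<omega> (U, \<phi>) m v = form_scale a \<omega> (W, \<psi>) m (D v)"
      by (simp add: form_scale_def)
  qed
  show "\<forall>(U, \<phi>)\<in>A. \<forall>v\<in>E. smooth_on (\<phi> ` U) (\<lambda>y. form_scale a \<omega> (U, \<phi>) (inv_into U \<phi> y) v)"
    unfolding smooth_on_def form_scale_def
    using Ck_on_mult smooth_funD[OF assms(1)] smooth_form_Ck_on[OF assms(2)] by blast
qed

section \<open>Smooth paths and pullbacks\<close>

lemma openin_path_preimage:
  assumes "path p" "path_image p \<subseteq> X" "(U, \<phi>) \<in> A"
  shows "openin (top_of_set {0..1}) ({0..1} \<inter> p -` U)"
  by (rule continuous_openin_preimage[OF _ _ chart(1)[OF assms(3)]])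
     (use assms(1,2) in \<open>auto simp: path_def path_image_def\<close>)

lemma path_Ck_on:
  assumes "p \<in> paths X A" "(U, \<phi>) \<in> A"
  shows "Ck_on k ({0..1} \<inter> p -` U) (\<lambda>t. \<phi> (p t))"
proof -
  have "smooth_on ({0..1} \<inter> p -` U) (\<phi> \<circ> p)" using assms unfolding paths_def by blast
  then show ?thesis by (simp add: smooth_on_def o_def)
qed

lemma pathsD:
  assumes "p \<in> paths X A"
  shows "path p" "path_image p \<subseteq> X" "t \<in> {0..1} \<Longrightarrow> p t \<in> X"
  using assms unfolding paths_def path_image_def by auto

lemma pathsI:
  assumes "path p" "path_image p \<subseteq> X"
    and "\<And>U \<phi> k. (U, \<phi>) \<in> A \<Longrightarrow> Ck_on k ({0..1} \<inter> p -` U) (\<lambda>t. \<phi> (p t))"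
  shows "p \<in> paths X A"
  using assms by (auto simp: paths_def smooth_on_def o_def)

lemma at_within_path_preimage:
  assumes "p \<in> paths X A" "(U, \<phi>) \<in> A" "t \<in> {0..1}" "p t \<in> U"
  shows "at t within {0..1} \<inter> p -` U = at t within {0..1}"
  by (rule at_within_openin[OF openin_path_preimage[OF pathsD(1,2)[OF assms(1)] assms(2)]]) (use assms in auto)

lemma path_chart_has_vector_derivative:
  assumes "p \<in> paths X A" "(U, \<phi>) \<in> A" "t \<in> {0..1}" "p t \<in> U"
  shows "((\<lambda>t. \<phi> (p t)) has_vector_derivative vector_derivative (\<phi> \<circ> p) (at t within {0..1})) (at t within {0..1})"
proof -
  have "Ck_on (Suc 0) ({0..1} \<inter> p -` U) (\<lambda>t. \<phi> (p t))" by (rule path_Ck_on[OF assms(1,2)])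
  then obtain f' where "\<forall>x\<in>{0..1} \<inter> p -` U. ((\<lambda>t. \<phi> (p t)) has_derivative f' x) (at x within {0..1} \<inter> p -` U)"
    unfolding Ck_on.simps by blast
  then have "((\<lambda>t. \<phi> (p t)) has_derivative f' t) (at t within {0..1} \<inter> p -` U)"
    using assms(3,4) by blast
  then have "((\<lambda>t. \<phi> (p t)) has_derivative f' t) (at t within {0..1})"
    unfolding at_within_path_preimage[OF assms] .
  then have "(\<lambda>t. \<phi> (p t)) differentiable (at t within {0..1})" by (rule differentiableI)
  then show ?thesis by (simp add: vector_derivative_works o_def)
qed

lemma unit_interval_not_trivial: "t \<in> {0..1} \<Longrightarrow> at t within {0..1::real} \<noteq> bot"
  using islimpt_Icc[of 0 1 t] by (simp add: trivial_limit_within)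

text \<open>The coordinate curve is fixed by P, so P of its velocity is again its velocity. The
  transformation rule for forms, stated for vectors of E, thereby applies to velocities.\<close>

lemma path_chart_derivative_in:
  assumes p: "p \<in> paths X A" and c: "(U, \<phi>) \<in> A" and t: "t \<in> {0..1}" "p t \<in> U"
    and v: "((\<lambda>t. \<phi> (p t)) has_vector_derivative v) (at t within {0..1})"
  shows "v \<in> E"
proof -
  have bl: "bounded_linear P" using tangent by (simp add: tangent_projection_def)
  have 1: "((\<lambda>t. P (\<phi> (p t))) has_vector_derivative P v) (at t within {0..1} \<inter> p -` U)"
    using bounded_linear.has_vector_derivative[OF bl v] by (simp add: at_within_path_preimage[OF p c t])
  have "((\<lambda>t. \<phi> (p t)) has_vector_derivative P v) (at t within {0..1} \<inter> p -` U)"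
  proof (rule has_vector_derivative_transform[OF _ _ 1])
    show "t \<in> {0..1} \<inter> p -` U" using t by auto
    show "\<phi> (p s) = P (\<phi> (p s))" if "s \<in> {0..1} \<inter> p -` U" for s
      using chart(5)[OF c] that by (intro P_id[symmetric]) auto
  qed
  then have "((\<lambda>t. \<phi> (p t)) has_vector_derivative P v) (at t within {0..1})"
    by (simp add: at_within_path_preimage[OF p c t])
  from vector_derivative_unique_within[OF unit_interval_not_trivial[OF t(1)] v this]
  show ?thesis using P_in by metis
qed

lemma transition_path_derivative:
  assumes p: "p \<in> paths X A" and c: "(U, \<phi>) \<in> A" "(W, \<psi>) \<in> A" and t: "t \<in> {0..1}" "p t \<in> U" "p t \<in> W"
    and v: "((\<lambda>t. \<phi> (p t)) has_vector_derivative v) (at t within {0..1})"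
    and w: "((\<lambda>t. \<psi> (p t)) has_vector_derivative w) (at t within {0..1})"
    and D: "((\<lambda>y. \<psi> (inv_into U \<phi> y)) has_derivative D) (at (\<phi> (p t)) within \<phi> ` (U \<inter> W))"
  shows "w = D v"
proof -
  define S where "S = ({0..1} \<inter> p -` U) \<inter> ({0..1} \<inter> p -` W)"
  have tS: "t \<in> S" using t by (auto simp: S_def)
  have "openin (top_of_set {0..1}) S"
    unfolding S_def by (rule openin_Int[OF openin_path_preimage openin_path_preimage]) (rule pathsD[OF p] c)+
  then have S: "at t within S = at t within {0..1}" using tS by (rule at_within_openin)
  have "((\<lambda>t. \<psi> (inv_into U \<phi> (\<phi> (p t)))) has_derivative (\<lambda>h. D (h *\<^sub>R v))) (at t within S)"
  proof (rule has_derivative_in_compose[where f = "\<lambda>t. \<phi> (p t)" and f' = "\<lambda>h. h *\<^sub>R v"])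
    show "((\<lambda>t. \<phi> (p t)) has_derivative (\<lambda>h. h *\<^sub>R v)) (at t within S)"
      using v by (simp add: S has_vector_derivative_def)
    show "((\<lambda>y. \<psi> (inv_into U \<phi> y)) has_derivative D) (at (\<phi> (p t)) within (\<lambda>t. \<phi> (p t)) ` S)"
      by (rule has_derivative_subset[OF D]) (auto simp: S_def)
  qed
  then have "((\<lambda>t. \<psi> (p t)) has_derivative (\<lambda>h. D (h *\<^sub>R v))) (at t within S)"
    by (rule has_derivative_transform[rotated 2]) (use tS chart_inv[OF c(1)] in \<open>auto simp: S_def\<close>)
  moreover have "D (h *\<^sub>R v) = h *\<^sub>R D v" for h
    using has_derivative_linear[OF D] by (rule linear_cmul)
  ultimately have "((\<lambda>t. \<psi> (p t)) has_vector_derivative D v) (at t within {0..1})"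
    by (simp add: S has_vector_derivative_def)
  with w show ?thesis by (rule vector_derivative_unique_within[OF unit_interval_not_trivial[OF t(1)]])
qed

text \<open>The chart picked by \<open>SOME\<close> in \<open>pullback\<close> may be replaced by
  any chart around p t: the two velocities are related by the derivative of the transition map, and
  forms transform with the same derivative.\<close>

lemma pullback_eq:
  assumes \<omega>: "\<omega> \<in> smooth_forms E A" and p: "p \<in> paths X A" and c: "(U, \<phi>) \<in> A"
    and t: "t \<in> {0..1}" "p t \<in> U"
    and v: "((\<lambda>t. \<phi> (p t)) has_vector_derivative v) (at t within {0..1})"
  shows "pullback A p \<omega> t = \<omega> (U, \<phi>) (p t) v"
proof -
  define c' where "c' = (SOME c. c \<in> A \<and> p t \<in> fst c)"
  have "c' \<in> A \<and> p t \<in> fst c'" unfolding c'_def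
    by (rule someI[of _ "(U, \<phi>)"]) (use c t in auto)
  then obtain W \<psi> where W: "c' = (W, \<psi>)" "(W, \<psi>) \<in> A" "p t \<in> W" by (cases c') auto
  define w where "w = vector_derivative (\<psi> \<circ> p) (at t within {0..1})"
  have w: "((\<lambda>t. \<psi> (p t)) has_vector_derivative w) (at t within {0..1})"
    unfolding w_def by (rule path_chart_has_vector_derivative[OF p W(2) t(1) W(3)])
  have "Ck_on (Suc 0) (\<phi> ` (U \<inter> W)) (\<lambda>y. \<psi> (inv_into U \<phi> y))" by (rule transition_smooth[OF c W(2)])
  then obtain D where D: "((\<lambda>y. \<psi> (inv_into U \<phi> y)) has_derivative D) (at (\<phi> (p t)) within \<phi> ` (U \<inter> W))"
    unfolding Ck_on.simps using t W(3) by blast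
  have "\<omega> (U, \<phi>) (p t) v = \<omega> (W, \<psi>) (p t) (D v)"
    by (rule smooth_form_transform[OF \<omega> c W(2) t(2) W(3) path_chart_derivative_in[OF p c t v] D])
  also have "D v = w" by (rule transition_path_derivative[OF p c W(2) t W(3) v w D, symmetric])
  finally show ?thesis
    unfolding pullback_def Let_def c'_def[symmetric] W(1) by (simp add: w_def)
qed

lemma continuous_on_pullback:
  assumes \<omega>: "\<omega> \<in> smooth_forms E A" and p: "p \<in> paths X A"
  shows "continuous_on {0..1} (pullback A p \<omega>)"
  unfolding continuous_on_eq_continuous_within
proof
  fix t :: real assume t: "t \<in> {0..1}"
  obtain U \<phi> where c: "(U, \<phi>) \<in> A" "p t \<in> U" using chart_cover[OF pathsD(3)[OF p t]] by blast
  \<comment> \<open>One chart is fixed near t, although the choice inside \<open>pullback\<close>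
    may change from point to point; \<open>pullback_eq\<close> rewrites every value in this
    chart.\<close>
  define S where "S = {0..1} \<inter> p -` U"
  have "Ck_on (Suc 0) S (\<lambda>t. \<phi> (p t))" unfolding S_def by (rule path_Ck_on[OF p c(1)])
  then obtain f' where f': "\<forall>s\<in>S. ((\<lambda>t. \<phi> (p t)) has_derivative f' s) (at s within S)"
      "continuous_on S (\<lambda>s. f' s 1)"
    unfolding Ck_on.simps by blast
  have v: "((\<lambda>t. \<phi> (p t)) has_vector_derivative f' s 1) (at s within {0..1})" if s: "s \<in> S" for s
  proof -
    have s': "s \<in> {0..1}" "p s \<in> U" using s by (auto simp: S_def)
    have d: "((\<lambda>t. \<phi> (p t)) has_derivative f' s) (at s within {0..1})"
      using bspec[OF f'(1) s] unfolding S_def at_within_path_preimage[OF p c(1) s'] .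
    have "f' s h = h *\<^sub>R f' s 1" for h
      using linear_cmul[OF has_derivative_linear[OF d], of h 1] by simp
    then have "f' s = (\<lambda>h. h *\<^sub>R f' s 1)" by blast
    with d show ?thesis unfolding has_vector_derivative_def by metis
  qed
  have "continuous_on S (\<lambda>s. \<omega> (U, \<phi>) (inv_into U \<phi> (\<phi> (p s))) (P b))" for b
    by (rule continuous_on_compose2[OF Ck_on_imp_continuous_on[OF smooth_form_Ck_on[OF \<omega> c(1) P_in]]
          Ck_on_imp_continuous_on[OF path_Ck_on[OF p c(1), folded S_def]]]) (auto simp: S_def)
  then have "continuous_on S (\<lambda>s. \<Sum>b\<in>Basis. (f' s 1 \<bullet> b) *\<^sub>R \<omega> (U, \<phi>) (inv_into U \<phi> (\<phi> (p s))) (P b))"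
    by (intro continuous_intros f'(2))
  then have "continuous_on S (pullback A p \<omega>)"
  proof (rule continuous_on_eq)
    fix s assume s: "s \<in> S"
    then have s': "s \<in> {0..1}" "p s \<in> U" by (auto simp: S_def)
    show "(\<Sum>b\<in>Basis. (f' s 1 \<bullet> b) *\<^sub>R \<omega> (U, \<phi>) (inv_into U \<phi> (\<phi> (p s))) (P b)) = pullback A p \<omega> s"
      unfolding chart_inv[OF c(1) s'(2)] pullback_eq[OF \<omega> p c(1) s' v[OF s]]
      by (rule smooth_form_expand[OF \<omega> c(1) s'(2) path_chart_derivative_in[OF p c(1) s' v[OF s]], symmetric])
  qed
  moreover have "t \<in> S" using t c by (simp add: S_def)
  ultimately have "continuous (at t within S) (pullback A p \<omega>)"
    by (simp add: continuous_on_eq_continuous_within)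
  then show "continuous (at t within {0..1}) (pullback A p \<omega>)"
    unfolding S_def at_within_path_preimage[OF p c(1) t c(2)] .
qed

lemma smooth_fun_path_derivative:
  assumes a: "smooth_fun a" and p: "p \<in> paths X A" and t: "t \<in> {0..1}"
  shows "((\<lambda>t. a (p t)) has_vector_derivative pullback A p (exterior_derivative a) t) (at t within {0..1})"
proof -
  obtain U \<phi> where c: "(U, \<phi>) \<in> A" "p t \<in> U" using chart_cover[OF pathsD(3)[OF p t]] by blast
  define v where "v = vector_derivative (\<phi> \<circ> p) (at t within {0..1})"
  note S = at_within_path_preimage[OF p c(1) t c(2)]
  have v: "((\<lambda>t. \<phi> (p t)) has_vector_derivative v) (at t within {0..1})"
    unfolding v_def by (rule path_chart_has_vector_derivative[OF p c(1) t c(2)])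
  note D = exterior_derivative_has_derivative[OF a c]
  have "((\<lambda>t. a (inv_into U \<phi> (\<phi> (p t)))) has_derivative (\<lambda>h. exterior_derivative a (U, \<phi>) (p t) (h *\<^sub>R v)))
      (at t within {0..1} \<inter> p -` U)"
  proof (rule has_derivative_in_compose[where f = "\<lambda>t. \<phi> (p t)" and f' = "\<lambda>h. h *\<^sub>R v"])
    show "((\<lambda>t. \<phi> (p t)) has_derivative (\<lambda>h. h *\<^sub>R v)) (at t within {0..1} \<inter> p -` U)"
      using v by (simp add: S has_vector_derivative_def)
    show "((\<lambda>y. a (inv_into U \<phi> y)) has_derivative exterior_derivative a (U, \<phi>) (p t))
       (at (\<phi> (p t)) within (\<lambda>t. \<phi> (p t)) ` ({0..1} \<inter> p -` U))"
      by (rule has_derivative_subset[OF D]) auto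
  qed
  then have "((\<lambda>t. a (p t)) has_derivative (\<lambda>h. exterior_derivative a (U, \<phi>) (p t) (h *\<^sub>R v)))
      (at t within {0..1} \<inter> p -` U)"
    by (rule has_derivative_transform[rotated 2]) (use t c chart_inv[OF c(1)] in auto)
  moreover have "exterior_derivative a (U, \<phi>) (p t) (h *\<^sub>R v) = h *\<^sub>R pullback A p (exterior_derivative a) t" for h
    using linear_cmul[OF has_derivative_linear[OF D], of h v]
      pullback_eq[OF exterior_derivative_smooth_form[OF a] p c(1) t c(2) v] by simp
  ultimately show ?thesis by (simp add: S has_vector_derivative_def)
qed

lemma pullback_form_scale: "pullback A p (form_scale a \<omega>) t = a (p t) * pullback A p \<omega> t"
  by (simp add: pullback_def form_scale_def Let_def)

text \<open>The velocity at t depends only on the germ of the path there. This lets the pullback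
  along a concatenated path be computed on two overlapping time windows.\<close>

lemma pullback_local:
  assumes \<omega>: "\<omega> \<in> smooth_forms E A" and c: "c \<in> paths X A" and q: "q \<in> paths X A"
    and N: "openin (top_of_set {0..1}) N" "t \<in> N" "\<And>s. s \<in> N \<Longrightarrow> c s = q s"
  shows "pullback A c \<omega> t = pullback A q \<omega> t"
proof -
  have t: "t \<in> {0..1}" using N openin_imp_subset by blast
  obtain U \<phi> where u: "(U, \<phi>) \<in> A" "q t \<in> U" using chart_cover[OF pathsD(3)[OF q t]] by blast
  define v where "v = vector_derivative (\<phi> \<circ> q) (at t within {0..1})"
  have v: "((\<lambda>t. \<phi> (q t)) has_vector_derivative v) (at t within {0..1})"
    unfolding v_def by (rule path_chart_has_vector_derivative[OF q u(1) t u(2)])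
  then have "((\<lambda>t. \<phi> (q t)) has_vector_derivative v) (at t within N)"
    by (simp add: at_within_openin[OF N(1,2)])
  then have "((\<lambda>t. \<phi> (c t)) has_vector_derivative v) (at t within N)"
    by (rule has_vector_derivative_transform[rotated 2]) (use N in auto)
  then have "((\<lambda>t. \<phi> (c t)) has_vector_derivative v) (at t within {0..1})"
    by (simp add: at_within_openin[OF N(1,2)])
  from pullback_eq[OF \<omega> c u(1) t _ this] pullback_eq[OF \<omega> q u(1) t u(2) v]
  show ?thesis using u N by simp
qed

lemma pathsI_local:
  assumes "\<And>t. t \<in> {0..1} \<Longrightarrow> \<exists>q N. q \<in> paths X A \<and> openin (top_of_set {0..1}) N \<and> t \<in> N \<and> (\<forall>s\<in>N. c s = q s)"
  shows "c \<in> paths X A"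
proof (rule pathsI)
  have "continuous (at t within {0..1}) c" if t: "t \<in> {0..1}" for t
  proof -
    obtain q N where N: "q \<in> paths X A" "openin (top_of_set {0..1}) N" "t \<in> N" "\<forall>s\<in>N. c s = q s"
      using assms[OF t] by blast
    have "continuous_on N q"
      using pathsD(1)[OF N(1)] openin_imp_subset[OF N(2)] unfolding path_def by (rule continuous_on_subset)
    then have "continuous_on N c" by (rule continuous_on_eq) (use N(4) in simp)
    then have "continuous (at t within N) c" using N(3) by (simp add: continuous_on_eq_continuous_within)
    then show ?thesis by (simp add: at_within_openin[OF N(2,3)])
  qed
  then show c: "path c" by (simp add: path_def continuous_on_eq_continuous_within)
  show im: "path_image c \<subseteq> X"
    unfolding path_image_def
  proof (rule image_subsetI)
    fix t :: real assume t: "t \<in> {0..1}"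
    obtain q N where N: "q \<in> paths X A" "t \<in> N" "\<forall>s\<in>N. c s = q s" using assms[OF t] by blast
    then show "c t \<in> X" using pathsD(3)[OF N(1) t] by simp
  qed
  fix U \<phi> k assume u: "(U, \<phi>) \<in> A"
  let ?S = "{0..1} \<inter> c -` U"
  have S: "openin (top_of_set {0..1}) ?S" by (rule openin_path_preimage[OF c im u])
  show "Ck_on k ?S (\<lambda>t. \<phi> (c t))"
  proof (rule Ck_on_local[OF tangent_projection_openin[OF tangent_projection_unit_interval S]])
    fix t assume t: "t \<in> ?S"
    then obtain q N where N: "q \<in> paths X A" "openin (top_of_set {0..1}) N" "t \<in> N" "\<forall>s\<in>N. c s = q s"
      using assms by blast
    have "openin (top_of_set ?S) (?S \<inter> N)"
      by (rule openin_subset_trans[OF openin_Int[OF S N(2)]]) auto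
    moreover have "Ck_on k (?S \<inter> N) (\<lambda>t. \<phi> (c t))"
      by (rule Ck_on_cong[OF Ck_on_subset[OF path_Ck_on[OF N(1) u]]]) (use N(4) in auto)
    ultimately show "\<exists>T. openin (top_of_set ?S) T \<and> t \<in> T \<and> Ck_on k T (\<lambda>t. \<phi> (c t))" using t N(3) by blast
  qed
qed

lemma reparametrize_paths:
  assumes p: "p \<in> paths X A" and \<alpha>: "\<And>k. Ck_on k {0..1} \<alpha>" "\<alpha> ` {0..1} \<subseteq> {0..1}"
  shows "(\<lambda>t. p (\<alpha> t)) \<in> paths X A"
proof (rule pathsI)
  show "path (\<lambda>t. p (\<alpha> t))"
    using pathsD(1)[OF p] continuous_on_compose2[OF _ Ck_on_imp_continuous_on[OF \<alpha>(1)] \<alpha>(2)]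
    unfolding path_def by blast
  show "path_image (\<lambda>t. p (\<alpha> t)) \<subseteq> X"
    using pathsD(3)[OF p] \<alpha>(2) unfolding path_image_def by blast
  fix U \<phi> k assume "(U, \<phi>) \<in> A"
  from path_Ck_on[OF p this]
  show "Ck_on k ({0..1} \<inter> (\<lambda>t. p (\<alpha> t)) -` U) (\<lambda>t. \<phi> (p (\<alpha> t)))"
    by (rule Ck_on_compose[OF _ Ck_on_subset[OF \<alpha>(1)]]) (use \<alpha>(2) in auto)
qed

lemma pullback_reparametrize:
  assumes \<omega>: "\<omega> \<in> smooth_forms E A" and p: "p \<in> paths X A"
    and \<alpha>: "\<And>k. Ck_on k {0..1} \<alpha>" "\<alpha> ` {0..1} \<subseteq> {0..1}"
    and t: "t \<in> {0..1}" and d: "(\<alpha> has_vector_derivative d) (at t within {0..1})"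
  shows "pullback A (\<lambda>t. p (\<alpha> t)) \<omega> t = d *\<^sub>R pullback A p \<omega> (\<alpha> t)"
proof -
  have \<alpha>t: "\<alpha> t \<in> {0..1}" using \<alpha>(2) t by blast
  obtain U \<phi> where c: "(U, \<phi>) \<in> A" "p (\<alpha> t) \<in> U" using chart_cover[OF pathsD(3)[OF p \<alpha>t]] by blast
  define v where "v = vector_derivative (\<phi> \<circ> p) (at (\<alpha> t) within {0..1})"
  have v: "((\<lambda>t. \<phi> (p t)) has_vector_derivative v) (at (\<alpha> t) within {0..1})"
    unfolding v_def by (rule path_chart_has_vector_derivative[OF p c(1) \<alpha>t c(2)])
  have "((\<lambda>t. \<phi> (p (\<alpha> t))) has_vector_derivative d *\<^sub>R v) (at t within {0..1})"
    using vector_diff_chain_within[OF d has_vector_derivative_within_subset[OF v \<alpha>(2)]] by (simp add: o_def)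
  from pullback_eq[OF \<omega> reparametrize_paths[OF p \<alpha>] c(1) t c(2) this]
  show ?thesis
    using pullback_eq[OF \<omega> p c(1) \<alpha>t c(2) v] linear_cmul[OF smooth_form_linear[OF \<omega> c]] by simp
qed

end

section \<open>Smooth concatenation of paths\<close>

lemma smooth_step_has_derivative: "(smooth_step has_field_derivative deriv smooth_step t) (at t)"
proof -
  have "Ck_on (Suc 0) UNIV smooth_step" by (rule Ck_on_smooth_step)
  then obtain f' where "\<forall>x\<in>UNIV. (smooth_step has_derivative f' x) (at x within UNIV)"
    unfolding Ck_on.simps by blast
  then have "smooth_step differentiable (at t)" using differentiableI by blast
  then show ?thesis by (simp add: DERIV_deriv_iff_real_differentiable)
qed

lemma deriv_smooth_step_eq_0:
  assumes "t < 1/3 \<or> t > 2/3"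
  shows "deriv smooth_step t = 0"
proof -
  have "(smooth_step has_field_derivative 0) (at t)"
  proof (cases "t < 1/3")
    case True
    then show ?thesis
      by (intro has_field_derivative_transform_within_open[OF DERIV_const[of 0], where S = "{..<1/3}"])
         (auto simp: smooth_step_eq_0)
  next
    case False
    with assms show ?thesis
      by (intro has_field_derivative_transform_within_open[OF DERIV_const[of 1], where S = "{2/3<..}"])
         (auto simp: smooth_step_eq_1)
  qed
  with smooth_step_has_derivative show ?thesis by (rule DERIV_unique)
qed

lemma smooth_step_shift:
  "Ck_on k S (\<lambda>t. smooth_step (2 * t - c))"
  "((\<lambda>t. smooth_step (2 * t - c)) has_vector_derivative 2 * deriv smooth_step (2 * t - c)) (at t within S)"
proof -
  have "Ck_on k S (\<lambda>t. 2 * t + (- c))"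
    by (intro Ck_on_add Ck_on_const Ck_on_linear bounded_linear_mult_right)
  from Ck_on_compose[OF Ck_on_smooth_step this] show "Ck_on k S (\<lambda>t. smooth_step (2 * t - c))" by simp
  have "((\<lambda>t. 2 * t - c) has_field_derivative 2) (at t)"
    by (auto intro!: derivative_eq_intros)
  from DERIV_chain2[OF smooth_step_has_derivative this]
  have "((\<lambda>t. smooth_step (2 * t - c)) has_field_derivative deriv smooth_step (2 * t - c) * 2) (at t within S)"
    by (rule has_field_derivative_at_within)
  then show "((\<lambda>t. smooth_step (2 * t - c)) has_vector_derivative 2 * deriv smooth_step (2 * t - c)) (at t within S)"
    by (simp add: has_real_derivative_iff_has_vector_derivative mult.commute)
qed

text \<open>The inner function climbs from 0 to 1/2 during [1/6, 1/3], rests there until 2/3 and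
  reaches 1 at 5/6. The rest makes the result smooth, and as a reparametrisation of
  \<open>p +++ r\<close> it is homotopic to the ordinary concatenation.\<close>

definition smooth_join :: "(real \<Rightarrow> 'a::topological_space) \<Rightarrow> (real \<Rightarrow> 'a) \<Rightarrow> real \<Rightarrow> 'a" where
  "smooth_join p r = (\<lambda>t. (p +++ r) ((smooth_step (2 * t) + smooth_step (2 * t - 1)) / 2))"

lemma smooth_join_left: "t < 2/3 \<Longrightarrow> smooth_join p r t = p (smooth_step (2 * t))"
  using smooth_step_bounds(2)[of "2 * t"] by (simp add: smooth_join_def joinpaths_def smooth_step_eq_0)

lemma smooth_join_right:
  assumes "t > 1/3" "pathfinish p = pathstart r"
  shows "smooth_join p r t = r (smooth_step (2 * t - 1))"
proof -
  have "2 * ((1 + smooth_step (2 * t - 1)) / 2) - 1 = smooth_step (2 * t - 1)" by (simp add: field_simps)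
  with assms smooth_step_bounds(1)[of "2 * t - 1"] show ?thesis
    by (auto simp: smooth_join_def joinpaths_def smooth_step_eq_1 pathfinish_def pathstart_def)
qed

lemma smooth_join_ends:
  "pathstart (smooth_join p r) = pathstart p" "pathfinish (smooth_join p r) = pathfinish r"
  by (simp_all add: smooth_join_def pathstart_def pathfinish_def joinpaths_def smooth_step_eq_0 smooth_step_eq_1)

lemma homotopic_smooth_join:
  assumes "path p" "path r" "path_image p \<subseteq> X" "path_image r \<subseteq> X" "pathfinish p = pathstart r"
  shows "homotopic_paths X (p +++ r) (smooth_join p r)"
proof (rule homotopic_paths_reparametrize)
  show "path (p +++ r)" "path_image (p +++ r) \<subseteq> X"
    using assms by (auto simp: path_image_join)
  have "continuous_on {0..1} (\<lambda>t. smooth_step (2 * t - 0))" "continuous_on {0..1} (\<lambda>t. smooth_step (2 * t - 1))"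
    by (rule Ck_on_imp_continuous_on[OF smooth_step_shift(1)])+
  then show "continuous_on {0..1} (\<lambda>t. (smooth_step (2 * t) + smooth_step (2 * t - 1)) / 2)"
    by (auto intro!: continuous_intros)
  have "0 \<le> (smooth_step (2 * t) + smooth_step (2 * t - 1)) / 2"
    "(smooth_step (2 * t) + smooth_step (2 * t - 1)) / 2 \<le> 1" for t
    using smooth_step_bounds[of "2 * t"] smooth_step_bounds[of "2 * t - 1"] by auto
  then show "(\<lambda>t. (smooth_step (2 * t) + smooth_step (2 * t - 1)) / 2) \<in> {0..1} \<rightarrow> {0..1}" by auto
qed (auto simp: smooth_join_def smooth_step_eq_0 smooth_step_eq_1)

text \<open>With a constant second half the motion is p run by the clock
  \<open>smooth_step (2 * t)\<close>. This compares F(p r) with F(p) when the return path is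
  constant.\<close>

lemma homotopic_smooth_join_const:
  assumes "path p" "path_image p \<subseteq> X"
  shows "homotopic_paths X p (smooth_join p (\<lambda>_. pathfinish p))"
proof (rule homotopic_paths_reparametrize[OF assms])
  show "continuous_on {0..1} (\<lambda>t. smooth_step (2 * t))"
    using Ck_on_imp_continuous_on[OF smooth_step_shift(1)[of 0 _ 0]] by simp
  show "(\<lambda>t. smooth_step (2 * t)) \<in> {0..1} \<rightarrow> {0..1}" using smooth_step_bounds by auto
  show "smooth_join p (\<lambda>_. pathfinish p) t = p (smooth_step (2 * t))" for t
  proof (cases "t < 2/3")
    case True
    then show ?thesis by (rule smooth_join_left)
  next
    case False
    then show ?thesis
      by (simp add: smooth_join_right pathstart_def pathfinish_def smooth_step_eq_1)
  qed
qed (auto simp: smooth_step_eq_0 smooth_step_eq_1)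

lemma nested_integral_cong:
  assumes "\<And>w t. w \<in> set ws \<Longrightarrow> t \<in> {0..1} \<Longrightarrow> f w t = g w t" "T \<in> {0..1}"
  shows "nested_integral (map f ws) T = nested_integral (map g ws) T"
  using assms
proof (induction ws arbitrary: T)
  case (Cons w ws)
  have "integral {0..T} (\<lambda>t. nested_integral (map f ws) t * f w t) =
      integral {0..T} (\<lambda>t. nested_integral (map g ws) t * g w t)"
    by (rule integral_cong) (use Cons in auto)
  then show ?case by simp
qed simp

section \<open>Segments in chart balls and the composition formula\<close>

context projected_manifold
begin

definition line_path :: "'a set \<Rightarrow> ('a \<Rightarrow> 'e) \<Rightarrow> 'e \<Rightarrow> 'e \<Rightarrow> real \<Rightarrow> 'a" where
  "line_path U \<phi> y e t = inv_into U \<phi> (y + t *\<^sub>R (e - y))"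

lemma segment_in_ball:
  assumes "y \<in> ball c r \<inter> E" "e \<in> ball c r \<inter> E" "t \<in> {0..1}"
  shows "y + t *\<^sub>R (e - y) \<in> ball c r \<inter> E"
proof -
  have "convex (ball c r \<inter> E)" by (intro convex_Int convex_ball subspace_imp_convex subspace_E)
  from convexD_alt[OF this assms(1,2), of t] assms(3) show ?thesis
    by (simp add: algebra_simps)
qed

lemma line_path_in_paths:
  assumes c: "(U, \<phi>) \<in> A" and B: "ball c r \<inter> E \<subseteq> \<phi> ` U" and y: "y \<in> ball c r \<inter> E" and e: "e \<in> ball c r \<inter> E"
  shows "line_path U \<phi> y e \<in> paths X A"
proof (rule pathsI)
  let ?l = "\<lambda>t. y + t *\<^sub>R (e - y)"
  have l: "?l t \<in> \<phi> ` U" if "t \<in> {0..1}" for t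
    using segment_in_ball[OF y e that] B by blast
  have inU: "line_path U \<phi> y e t \<in> U" if "t \<in> {0..1}" for t
    using l[OF that] chart_inv[OF c] by (auto simp: line_path_def)
  have lc: "Ck_on k S ?l" for k S
    by (intro Ck_on_add Ck_on_const Ck_on_linear bounded_linear_scaleR_left)
  have "continuous_on (\<phi> ` U) (inv_into U \<phi>)" using chart(3)[OF c] by (simp add: homeomorphism_def)
  then show "path (line_path U \<phi> y e)"
    unfolding path_def line_path_def[abs_def]
    by (rule continuous_on_compose2[OF _ Ck_on_imp_continuous_on[OF lc]]) (use l in blast)
  show "path_image (line_path U \<phi> y e) \<subseteq> X"
    using inU chart(4)[OF c] by (auto simp: path_image_def)
  fix W \<psi> k assume w: "(W, \<psi>) \<in> A"
  show "Ck_on k ({0..1} \<inter> line_path U \<phi> y e -` W) (\<lambda>t. \<psi> (line_path U \<phi> y e t))"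
    unfolding line_path_def
  proof (rule Ck_on_compose[OF transition_smooth[OF c w] lc], rule image_subsetI)
    fix t assume t: "t \<in> {0..1} \<inter> (\<lambda>t. inv_into U \<phi> (?l t)) -` W"
    then obtain m where "m \<in> U" "?l t = \<phi> m" using l by blast
    then show "?l t \<in> \<phi> ` (U \<inter> W)" using t chart_inv[OF c] by auto
  qed
qed

lemma line_path_pullback:
  assumes c: "(U, \<phi>) \<in> A" and B: "ball c r \<inter> E \<subseteq> \<phi> ` U" and y: "y \<in> ball c r \<inter> E" and e: "e \<in> ball c r \<inter> E"
    and \<omega>: "\<omega> \<in> smooth_forms E A" and t: "t \<in> {0..1}"
  shows "pullback A (line_path U \<phi> y e) \<omega> t =
    (\<Sum>b\<in>Basis. ((e - y) \<bullet> b) *\<^sub>R \<omega> (U, \<phi>) (inv_into U \<phi> (y + t *\<^sub>R (e - y))) (P b))"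
proof -
  let ?l = "\<lambda>t. y + t *\<^sub>R (e - y)"
  have \<phi>l: "\<phi> (line_path U \<phi> y e s) = ?l s" "line_path U \<phi> y e s \<in> U" if "s \<in> {0..1}" for s
    using segment_in_ball[OF y e that] B by (auto simp: line_path_def f_inv_into_f inv_into_into)
  have "(?l has_vector_derivative (e - y)) (at t within {0..1})"
    by (auto intro!: derivative_eq_intros)
  then have "((\<lambda>t. \<phi> (line_path U \<phi> y e t)) has_vector_derivative (e - y)) (at t within {0..1})"
    by (rule has_vector_derivative_transform[rotated 2]) (use t \<phi>l in auto)
  from pullback_eq[OF \<omega> line_path_in_paths[OF c B y e] c t \<phi>l(2)[OF t] this]
  have "pullback A (line_path U \<phi> y e) \<omega> t = \<omega> (U, \<phi>) (line_path U \<phi> y e t) (e - y)" .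
  also have "\<dots> = (\<Sum>b\<in>Basis. ((e - y) \<bullet> b) *\<^sub>R \<omega> (U, \<phi>) (line_path U \<phi> y e t) (P b))"
    by (rule smooth_form_expand[OF \<omega> c \<phi>l(2)[OF t]]) (use y e subspace_E in \<open>auto intro: subspace_diff\<close>)
  finally show ?thesis by (simp add: line_path_def)
qed

text \<open>As in \<^const>\<open>nested_integral\<close>, the form integrated last comes first in the list.\<close>

definition iint :: "('a, 'e) form list \<Rightarrow> (real \<Rightarrow> 'a) \<Rightarrow> complex" where
  "iint ws p = nested_integral (map (pullback A p) ws) 1"

lemma iterated_integral_eq_iint: "iterated_integral A ws p = iint (rev ws) p"
  by (simp add: iterated_integral_def iint_def)

text \<open>By \<open>line_path_pullback\<close>, the pullback along the segment from y to e is a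
  coordinate expression jointly smooth in (y, t), so \<open>Ck_on_nested_integral\<close> applies.
  Convexity of the ball within E keeps the segments in the chart and admits differentiation under
  the integral.\<close>

lemma Ck_on_iint_line_path:
  assumes c: "(U, \<phi>) \<in> A" and B: "ball c r \<inter> E \<subseteq> \<phi> ` U" and e: "e \<in> ball c r \<inter> E"
    and ws: "set ws \<subseteq> smooth_forms E A"
  shows "Ck_on k (ball c r \<inter> E) (\<lambda>y. iint ws (line_path U \<phi> y e))"
proof -
  define f where "f \<omega> y t = (\<Sum>b\<in>Basis. ((e - y) \<bullet> b) *\<^sub>R \<omega> (U, \<phi>) (inv_into U \<phi> (y + t *\<^sub>R (e - y))) (P b))"
    for \<omega> :: "('a, 'e) form" and y t
  let ?B = "ball c r \<inter> E"
  have "Ck_on k (?B \<times> {0..1}) (\<lambda>z. f \<omega> (fst z) (snd z))" if \<omega>: "\<omega> \<in> set ws" for \<omega>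
  proof -
    have "Ck_on k (?B \<times> {0..1}) (\<lambda>z. e + (-1) *\<^sub>R fst z)" for k
      by (intro Ck_on_add Ck_on_scaleR Ck_on_const Ck_on_linear bounded_linear_fst)
    then have d: "Ck_on k (?B \<times> {0..1}) (\<lambda>z. e - fst z)" for k by simp
    have l: "Ck_on k (?B \<times> {0..1}) (\<lambda>z. fst z + snd z *\<^sub>R (e - fst z))" for k
      by (intro Ck_on_add Ck_on_scaleR d Ck_on_linear bounded_linear_fst bounded_linear_snd)
    have im: "(\<lambda>z. fst z + snd z *\<^sub>R (e - fst z)) ` (?B \<times> {0..1}) \<subseteq> \<phi> ` U"
    proof (rule image_subsetI)
      fix z :: "'e \<times> real" assume "z \<in> ?B \<times> {0..1}"
      then show "fst z + snd z *\<^sub>R (e - fst z) \<in> \<phi> ` U"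
        using segment_in_ball[OF _ e, of "fst z" "snd z"] B by auto
    qed
    have "Ck_on k (?B \<times> {0..1}) (\<lambda>z. \<omega> (U, \<phi>) (inv_into U \<phi> (fst z + snd z *\<^sub>R (e - fst z))) (P b))" for k b
      by (rule Ck_on_compose[OF smooth_form_Ck_on[OF subsetD[OF ws \<omega>] c P_in] l im])
    then show ?thesis unfolding f_def by (intro Ck_on_sum Ck_on_scaleR Ck_on_inner Ck_on_const d)
  qed
  then have "Ck_on k (?B \<times> {0..1}) (\<lambda>z. nested_integral (map (\<lambda>\<omega>. f \<omega> (fst z)) ws) (snd z))"
    by (intro Ck_on_nested_integral convex_Int convex_ball subspace_imp_convex subspace_E ballI)
  then have "Ck_on k ?B (\<lambda>y. nested_integral (map (\<lambda>\<omega>. f \<omega> (fst (y, 1::real))) ws) (snd (y, 1::real)))"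
    by (rule Ck_on_compose[OF _ Ck_on_Pair[OF Ck_on_linear[OF bounded_linear_ident] Ck_on_const]]) auto
  then show ?thesis
  proof (rule Ck_on_cong)
    fix y assume y: "y \<in> ?B"
    show "nested_integral (map (\<lambda>\<omega>. f \<omega> (fst (y, 1::real))) ws) (snd (y, 1::real)) = iint ws (line_path U \<phi> y e)"
      unfolding iint_def fst_conv snd_conv
      by (rule nested_integral_cong) (use line_path_pullback[OF c B y e] ws in \<open>auto simp: f_def\<close>)
  qed
qed

lemma smooth_join_in_paths:
  assumes p: "p \<in> paths X A" and r: "r \<in> paths X A" and pr: "pathfinish p = pathstart r"
  shows "smooth_join p r \<in> paths X A"
proof (rule pathsI_local)
  fix t :: real assume t: "t \<in> {0..1}"
  have im: "(\<lambda>t. smooth_step (2 * t - c)) ` {0..1} \<subseteq> {0..1}" for c using smooth_step_bounds by auto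
  show "\<exists>q N. q \<in> paths X A \<and> openin (top_of_set {0..1}) N \<and> t \<in> N \<and> (\<forall>s\<in>N. smooth_join p r s = q s)"
  \<comment> \<open>The windows t < 2/3 and t > 1/3 are open and cover [0, 1]; on each the joined
    path is a smooth reparametrisation of one half.\<close>
  proof (cases "t < 2/3")
    case True
    have "openin (top_of_set {0..1}) ({0..1} \<inter> {..<2/3::real})" by (intro openin_open_Int open_lessThan)
    with True t show ?thesis
      using reparametrize_paths[OF p smooth_step_shift(1) im, of 0]
      by (intro exI[of _ "\<lambda>t. p (smooth_step (2 * t - 0))"] exI[of _ "{0..1} \<inter> {..<2/3}"]) (auto simp: smooth_join_left)
  next
    case False
    have "openin (top_of_set {0..1}) ({0..1} \<inter> {1/3::real<..})" by (intro openin_open_Int open_greaterThan)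
    with False t show ?thesis
      using reparametrize_paths[OF r smooth_step_shift(1) im, of 1] smooth_join_right[OF _ pr]
      by (intro exI[of _ "\<lambda>t. r (smooth_step (2 * t - 1))"] exI[of _ "{0..1} \<inter> {1/3<..}"]) auto
  qed
qed

text \<open>For t < 2/3 the second clock has derivative 0, afterwards the first one has, so the sum
  is always the reparametrised pullback of a single half.\<close>

lemma pullback_smooth_join:
  assumes \<omega>: "\<omega> \<in> smooth_forms E A" and p: "p \<in> paths X A" and r: "r \<in> paths X A"
    and pr: "pathfinish p = pathstart r" and t: "t \<in> {0..1}"
  shows "pullback A (smooth_join p r) \<omega> t =
    (2 * deriv smooth_step (2 * t - 0)) *\<^sub>R pullback A p \<omega> (smooth_step (2 * t - 0)) +
    (2 * deriv smooth_step (2 * t - 1)) *\<^sub>R pullback A r \<omega> (smooth_step (2 * t - 1))"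
proof -
  have im: "(\<lambda>t. smooth_step (2 * t - c)) ` {0..1} \<subseteq> {0..1}" for c using smooth_step_bounds by auto
  note J = smooth_join_in_paths[OF p r pr]
  show ?thesis
  proof (cases "t < 2/3")
    case True
    have "openin (top_of_set {0..1}) ({0..1} \<inter> {..<2/3::real})" by (intro openin_open_Int open_lessThan)
    from pullback_local[OF \<omega> J reparametrize_paths[OF p smooth_step_shift(1) im] this, of t 0]
    have "pullback A (smooth_join p r) \<omega> t = pullback A (\<lambda>t. p (smooth_step (2 * t - 0))) \<omega> t"
      using t True smooth_join_left by auto
    also have "\<dots> = (2 * deriv smooth_step (2 * t - 0)) *\<^sub>R pullback A p \<omega> (smooth_step (2 * t - 0))"
      by (rule pullback_reparametrize[OF \<omega> p smooth_step_shift(1) im t smooth_step_shift(2)])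
    finally show ?thesis using True by (simp add: deriv_smooth_step_eq_0)
  next
    case False
    have "openin (top_of_set {0..1}) ({0..1} \<inter> {1/3::real<..})" by (intro openin_open_Int open_greaterThan)
    from pullback_local[OF \<omega> J reparametrize_paths[OF r smooth_step_shift(1) im] this, of t 1]
    have "pullback A (smooth_join p r) \<omega> t = pullback A (\<lambda>t. r (smooth_step (2 * t - 1))) \<omega> t"
      using t False smooth_join_right[OF _ pr] by auto
    also have "\<dots> = (2 * deriv smooth_step (2 * t - 1)) *\<^sub>R pullback A r \<omega> (smooth_step (2 * t - 1))"
      by (rule pullback_reparametrize[OF \<omega> r smooth_step_shift(1) im t smooth_step_shift(2)])
    finally show ?thesis using False by (simp add: deriv_smooth_step_eq_0)
  qed
qed

text \<open>\<open>nested_integral_concat\<close> applies to the clocks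
  \<open>smooth_step (2 * t)\<close> and \<open>smooth_step (2 * t - 1)\<close>: the first has
  arrived at 1 by t = 1/3, the second starts only after t = 2/3.\<close>

lemma iint_smooth_join:
  assumes ws: "set ws \<subseteq> smooth_forms E A" and p: "p \<in> paths X A" and r: "r \<in> paths X A"
    and pr: "pathfinish p = pathstart r"
  shows "iint ws (smooth_join p r) = (\<Sum>k\<le>length ws. iint (take k ws) r * iint (drop k ws) p)"
proof -
  have im: "(\<lambda>t. smooth_step (2 * t - c)) ` {0..1} \<subseteq> {0..1}" for c using smooth_step_bounds by auto
  have d: "deriv smooth_step (2 * t - 1) = 0" if "t < 2/3" for t
    using that by (intro deriv_smooth_step_eq_0) auto
  have d': "deriv smooth_step (2 * t) = 0" if "t > 1/3" for t
    using that by (intro deriv_smooth_step_eq_0) auto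
  have "iint ws (smooth_join p r) = (\<Sum>k\<le>length ws.
      nested_integral (map (pullback A r) (take k ws)) (smooth_step (2 * 1 - 1)) *
      nested_integral (map (pullback A p) (drop k ws)) (smooth_step (2 * 1 - 0)))"
    unfolding iint_def
  proof (rule nested_integral_concat[where \<alpha> = "\<lambda>t. smooth_step (2 * t - 0)" and \<beta> = "\<lambda>t. smooth_step (2 * t - 1)"
        and \<alpha>' = "\<lambda>t. 2 * deriv smooth_step (2 * t - 0)"
        and \<beta>' = "\<lambda>t. 2 * deriv smooth_step (2 * t - 1)"])
    show "\<forall>w\<in>set ws. continuous_on {0..1} (pullback A p w)" "\<forall>w\<in>set ws. continuous_on {0..1} (pullback A r w)"
      using continuous_on_pullback p r ws by blast+
    fix t :: real
    assume t: "t \<in> {0..1}"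
    show "smooth_step (2 * t - 1) = 0" if "2 * deriv smooth_step (2 * t - 0) \<noteq> 0"
    proof -
      have "\<not> t > 1/3" using that d'[of t] by auto
      then show ?thesis by (intro smooth_step_eq_0) auto
    qed
    show "2 * deriv smooth_step (2 * t - 0) = 0" if "2 * deriv smooth_step (2 * t - 1) \<noteq> 0"
    proof -
      have "\<not> t < 2/3" using that d[of t] by auto
      then show ?thesis using d'[of t] by simp
    qed
    show "pullback A (smooth_join p r) w t =
       (2 * deriv smooth_step (2 * t - 0)) *\<^sub>R pullback A p w (smooth_step (2 * t - 0)) +
       (2 * deriv smooth_step (2 * t - 1)) *\<^sub>R pullback A r w (smooth_step (2 * t - 1))"
      if "w \<in> set ws" for w using pullback_smooth_join[OF _ p r pr t] ws that by blast
  qed (rule smooth_step_shift(2) im | simp add: smooth_step_eq_0)+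
  then show ?thesis by (simp add: iint_def smooth_step_eq_1)
qed

lemma iint_mult_endpoint:
  assumes a: "smooth_fun a" and p: "p \<in> paths X A" and ws: "set (w # ws) \<subseteq> smooth_forms E A"
  shows "a (p 1) * iint (w # ws) p = iint (exterior_derivative a # w # ws) p + iint (form_scale a w # ws) p"
proof -
  have "a (p 1) * nested_integral (pullback A p w # map (pullback A p) ws) 1 =
    nested_integral (pullback A p (exterior_derivative a) # pullback A p w # map (pullback A p) ws) 1 +
    nested_integral ((\<lambda>t. a (p t) * pullback A p w t) # map (pullback A p) ws) 1"
    by (rule nested_integral_by_parts[OF smooth_fun_path_derivative[OF a p]])
       (use ws continuous_on_pullback[OF _ p] in auto)
  moreover have "pullback A p (form_scale a w) = (\<lambda>t. a (p t) * pullback A p w t)"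
    using pullback_form_scale by blast
  ultimately show ?thesis by (simp add: iint_def del: nested_integral.simps)
qed

lemma iint_exterior_derivative:
  assumes "smooth_fun a" "p \<in> paths X A"
  shows "iint [exterior_derivative a] p = a (p 1) - a (p 0)"
  using nested_integral_single[OF smooth_fun_path_derivative[OF assms], of 1]
  by (simp add: iint_def del: nested_integral.simps)

section \<open>Smooth families of return paths\<close>

definition chart_ball :: "'a set \<Rightarrow> ('a \<Rightarrow> 'e) \<Rightarrow> 'e \<Rightarrow> real \<Rightarrow> 'a set" where
  "chart_ball U \<phi> c r = U \<inter> \<phi> -` ball c r"

lemma openin_chart_ball:
  assumes "(U, \<phi>) \<in> A"
  shows "openin (top_of_set X) (chart_ball U \<phi> c r)"
proof -
  have "continuous_on U \<phi>" using chart(3)[OF assms] by (simp add: homeomorphism_def)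
  then have "openin (top_of_set U) (chart_ball U \<phi> c r)"
    unfolding chart_ball_def by (rule continuous_openin_preimage_gen[OF _ open_ball])
  then show ?thesis using chart(1)[OF assms] by (rule openin_trans)
qed

lemma chart_ball_exists:
  assumes "m \<in> X"
  obtains U \<phi> r where "(U, \<phi>) \<in> A" "m \<in> U" "r > 0" "ball (\<phi> m) r \<inter> E \<subseteq> \<phi> ` U"
proof -
  obtain U \<phi> where c: "(U, \<phi>) \<in> A" "m \<in> U" using chart_cover[OF assms] by blast
  then obtain r where "r > 0" "ball (\<phi> m) r \<inter> E \<subseteq> \<phi> ` U"
    using chart(2)[OF c(1)] unfolding openin_contains_ball by blast
  with c that show thesis by blast
qed

text \<open>Outside U the chart map has arbitrary values, so the bump is set to 0 there explicitly;
  that the result is smooth follows from \<open>smooth_fun_cutoff_mult\<close>.\<close>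

definition cutoff :: "'a set \<Rightarrow> ('a \<Rightarrow> 'e) \<Rightarrow> 'e \<Rightarrow> real \<Rightarrow> 'a \<Rightarrow> complex" where
  "cutoff U \<phi> c r m = (if m \<in> U then complex_of_real (bump c r (\<phi> m)) else 0)"

lemma cutoff_eq_0: "0 < r \<Longrightarrow> m \<notin> chart_ball U \<phi> c r \<Longrightarrow> cutoff U \<phi> c r m = 0"
  by (auto simp: cutoff_def chart_ball_def bump_eq_0)

lemma cutoff_eq_1: "0 < r \<Longrightarrow> m \<in> chart_ball U \<phi> c (r / 2) \<Longrightarrow> cutoff U \<phi> c r m = 1"
  by (auto simp: cutoff_def chart_ball_def bump_eq_1)

text \<open>The product vanishes off K, the copy in U of a smaller closed ball. K is compact, hence
  closed by the Hausdorff property, so its complement is open; it covers X together with the chart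
  ball, on which h is smooth.\<close>

lemma smooth_fun_cutoff_mult:
  assumes c: "(U, \<phi>) \<in> A" and r: "0 < r" and B: "ball c r \<inter> E \<subseteq> \<phi> ` U"
    and h: "\<And>k. Ck_on k (ball c r \<inter> E) (\<lambda>y. h (inv_into U \<phi> y))"
  shows "smooth_fun (\<lambda>m. cutoff U \<phi> c r m * h m)"
proof (rule smooth_funI_local)
  fix m assume m: "m \<in> X"
  let ?N = "chart_ball U \<phi> c r"
  show "\<exists>W \<psi> N. (W, \<psi>) \<in> A \<and> openin (top_of_set X) N \<and> m \<in> N \<and> N \<subseteq> W \<and>
    (\<forall>k. Ck_on k (\<psi> ` N) (\<lambda>y. cutoff U \<phi> c r (inv_into W \<psi> y) * h (inv_into W \<psi> y)))"
  proof (cases "m \<in> ?N")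
    case True
    have im: "\<phi> ` ?N \<subseteq> ball c r \<inter> E" using chart(5)[OF c] by (auto simp: chart_ball_def)
    have "Ck_on k (\<phi> ` ?N) (\<lambda>y. cutoff U \<phi> c r (inv_into U \<phi> y) * h (inv_into U \<phi> y))" for k
    proof (rule Ck_on_cong)
      have "Ck_on k (\<phi> ` ?N) (\<lambda>y. complex_of_real (bump c r y))"
        by (rule Ck_on_compose[OF Ck_on_linear[OF bounded_linear_of_real] Ck_on_bump subset_UNIV])
      then show "Ck_on k (\<phi> ` ?N) (\<lambda>y. complex_of_real (bump c r y) * h (inv_into U \<phi> y))"
        by (rule Ck_on_mult[OF _ Ck_on_subset[OF h im]])
      fix y assume "y \<in> \<phi> ` ?N"
      then show "complex_of_real (bump c r y) * h (inv_into U \<phi> y) =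
          cutoff U \<phi> c r (inv_into U \<phi> y) * h (inv_into U \<phi> y)"
        by (auto simp: cutoff_def chart_ball_def chart_inv[OF c])
    qed
    moreover have "?N \<subseteq> U" by (auto simp: chart_ball_def)
    ultimately show ?thesis using c True openin_chart_ball[OF c] by blast
  next
    case False
    define K where "K = inv_into U \<phi> ` (cball c (9/10 * r) \<inter> E)"
    have sub: "cball c (9/10 * r) \<inter> E \<subseteq> ball c r \<inter> E" using r by (auto simp: dist_norm)
    have K: "K \<subseteq> ?N"
    proof
      fix x assume "x \<in> K"
      then obtain y where y: "y \<in> ball c r \<inter> E" "x = inv_into U \<phi> y" using sub unfolding K_def by blast
      then obtain u where "u \<in> U" "y = \<phi> u" using B by blast
      with y show "x \<in> ?N" using chart_inv[OF c] by (auto simp: chart_ball_def)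
    qed
    have "continuous_on (cball c (9/10 * r) \<inter> E) (inv_into U \<phi>)"
    proof (rule continuous_on_subset)
      show "continuous_on (\<phi> ` U) (inv_into U \<phi>)" using chart(3)[OF c] by (simp add: homeomorphism_def)
    qed (use sub B in blast)
    moreover have "compact (cball c (9/10 * r) \<inter> E)"
      using closed_subspace[OF subspace_E] by (intro compact_Int_closed) auto
    ultimately have "compact K" unfolding K_def by (rule compact_continuous_image)
    then have "closed K" by (rule compact_imp_closed)
    moreover have "K \<subseteq> X" using K chart(4)[OF c] by (auto simp: chart_ball_def)
    ultimately have Kc: "closedin (top_of_set X) K" by (intro closed_subset)
    obtain W \<psi> where w: "(W, \<psi>) \<in> A" "m \<in> W" using chart_cover[OF m] by blast
    have z: "cutoff U \<phi> c r x = 0" if "x \<notin> K" for x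
    proof (cases "x \<in> U")
      case True
      have "\<phi> x \<notin> cball c (9/10 * r)"
      proof
        assume "\<phi> x \<in> cball c (9/10 * r)"
        then have "inv_into U \<phi> (\<phi> x) \<in> K" unfolding K_def using chart(5)[OF c] True by blast
        then show False using that chart_inv[OF c True] by simp
      qed
      then show ?thesis using r by (simp add: cutoff_def bump_eq_0)
    qed (simp add: cutoff_def)
    have "Ck_on k (\<psi> ` (W - K)) (\<lambda>y. cutoff U \<phi> c r (inv_into W \<psi> y) * h (inv_into W \<psi> y))" for k
      by (rule Ck_on_cong[OF Ck_on_const[of _ _ 0]]) (auto simp: chart_inv[OF w(1)] z)
    moreover have "openin (top_of_set X) (W - K)" by (rule openin_diff[OF chart(1)[OF w(1)] Kc])
    ultimately show ?thesis using w False K by blast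
  qed
qed

text \<open>Second countability yields countably many balls by Lindelof. The balls of half radius
  are the ones that must cover, because there the bumps equal 1.\<close>

lemma countable_chart_ball_cover:
  assumes "X \<noteq> {}"
  shows "\<exists>U \<phi> c r. (\<forall>k::nat. (U k, \<phi> k) \<in> A \<and> c k \<in> E \<and> 0 < r k \<and> ball (c k) (r k) \<inter> E \<subseteq> \<phi> k ` U k) \<and>
    X = (\<Union>k. chart_ball (U k) (\<phi> k) (c k) (r k / 2))"
proof -
  have "\<forall>m\<in>X. \<exists>U \<phi> r. (U, \<phi>) \<in> A \<and> m \<in> U \<and> r > 0 \<and> ball (\<phi> m) r \<inter> E \<subseteq> \<phi> ` U"
    using chart_ball_exists by metis
  then obtain U \<phi> r where u: "\<forall>m\<in>X. (U m, \<phi> m) \<in> A \<and> m \<in> U m \<and> r m > 0 \<and> ball (\<phi> m m) (r m) \<inter> E \<subseteq> \<phi> m ` U m"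
    unfolding bchoice_iff by blast
  define V where "V m = chart_ball (U m) (\<phi> m) (\<phi> m m) (r m / 2)" for m
  have V: "openin (top_of_set X) (V m)" "m \<in> V m" if "m \<in> X" for m
    using u that openin_chart_ball by (auto simp: V_def chart_ball_def)
  obtain \<F> where \<F>: "\<F> \<subseteq> V ` X" "countable \<F>" "\<Union>\<F> = \<Union>(V ` X)"
    by (rule Lindelof_openin[of "V ` X" X]) (use V in auto)
  obtain C where C: "C \<subseteq> X" "countable C" "\<F> = V ` C"
    using \<F>(1,2) countable_subset_image[of \<F> V X] by auto
  have XV: "X = \<Union>(V ` X)" using V openin_imp_subset by fastforce
  then have XC: "X = \<Union>(V ` C)" using \<F>(3) C(3) by simp
  then have Cne: "C \<noteq> {}" using assms by auto
  \<comment> \<open>C may be finite; the enumeration then repeats points, which the cover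
    permits.\<close>
  define x where "x = from_nat_into C"
  have rx: "range x = C" unfolding x_def by (rule range_from_nat_into[OF Cne C(2)])
  then have xX: "x k \<in> X" for k using C(1) by blast
  show ?thesis
  proof (intro exI[of _ "\<lambda>k. U (x k)"] exI[of _ "\<lambda>k. \<phi> (x k)"] exI[of _ "\<lambda>k. \<phi> (x k) (x k)"]
      exI[of _ "\<lambda>k. r (x k)"] conjI allI)
    show "(U (x k), \<phi> (x k)) \<in> A" "0 < r (x k)"
      "ball (\<phi> (x k) (x k)) (r (x k)) \<inter> E \<subseteq> \<phi> (x k) ` U (x k)" for k
      using u xX by blast+
    show "\<phi> (x k) (x k) \<in> E" for k using u xX[of k] chart(5) by blast
    have "(\<Union>k. V (x k)) = \<Union>(V ` C)" unfolding rx[symmetric] by blast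
    then show "X = (\<Union>k. chart_ball (U (x k)) (\<phi> (x k)) (\<phi> (x k) (x k)) (r (x k) / 2))"
      using XC unfolding V_def by simp
  qed
qed

section \<open>Smooth path-connectedness and the family of return paths\<close>

lemma line_path_ends: "pathstart (line_path U \<phi> y e) = inv_into U \<phi> y" "pathfinish (line_path U \<phi> y e) = inv_into U \<phi> e"
  by (simp_all add: line_path_def pathstart_def pathfinish_def)

lemma const_in_paths: "x \<in> X \<Longrightarrow> (\<lambda>_. x) \<in> paths X A"
  by (rule pathsI) (auto simp: path_def path_image_def intro: Ck_on_const)

text \<open>The set of points that reach x0 by a smooth path is open and closed: inside a chart
  ball, a coordinate segment joined in front of a path transfers reachability from any point to any
  other.\<close>

lemma smooth_path_connected:
  assumes "connected X" and x0: "x0 \<in> X" and x: "x \<in> X"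
  obtains p where "p \<in> paths X A" "pathstart p = x" "pathfinish p = x0"
proof -
  define S where "S = {x \<in> X. \<exists>p\<in>paths X A. pathstart p = x \<and> pathfinish p = x0}"
  have nbhd: "\<exists>N. openin (top_of_set X) N \<and> m \<in> N \<and> (\<forall>z\<in>N. z \<in> S \<longleftrightarrow> m \<in> S)" if m: "m \<in> X" for m
  proof -
    obtain U \<phi> r where u: "(U, \<phi>) \<in> A" "m \<in> U" "r > 0" "ball (\<phi> m) r \<inter> E \<subseteq> \<phi> ` U"
      using chart_ball_exists[OF m] by blast
    let ?N = "chart_ball U \<phi> (\<phi> m) r"
    have step: "z' \<in> S" if z: "z \<in> ?N" "z' \<in> ?N" and zS: "z \<in> S" for z z'
    proof -
      have b: "\<phi> z \<in> ball (\<phi> m) r \<inter> E" "\<phi> z' \<in> ball (\<phi> m) r \<inter> E" "z \<in> U" "z' \<in> U"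
        using z chart(5)[OF u(1)] by (auto simp: chart_ball_def)
      obtain p where p: "p \<in> paths X A" "pathstart p = z" "pathfinish p = x0" using zS by (auto simp: S_def)
      let ?l = "line_path U \<phi> (\<phi> z') (\<phi> z)"
      have l: "?l \<in> paths X A" by (rule line_path_in_paths[OF u(1,4) b(2,1)])
      have "pathfinish ?l = pathstart p" "pathstart ?l = z'"
        using p(2) chart_inv[OF u(1)] b by (simp_all add: line_path_ends)
      then have "smooth_join ?l p \<in> paths X A" "pathstart (smooth_join ?l p) = z'" "pathfinish (smooth_join ?l p) = x0"
        using smooth_join_in_paths[OF l p(1)] p(3) by (simp_all add: smooth_join_ends)
      moreover have "z' \<in> X" using b(4) chart(4)[OF u(1)] by blast
      ultimately show ?thesis unfolding S_def by blast
    qed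
    have "m \<in> ?N" using u by (simp add: chart_ball_def)
    then show ?thesis using openin_chart_ball[OF u(1)] step by blast
  qed
  have "openin (top_of_set X) S"
    unfolding openin_subopen[of _ S]
  proof
    fix m assume "m \<in> S"
    then have "m \<in> X" by (simp add: S_def)
    with nbhd[OF this] \<open>m \<in> S\<close> show "\<exists>T. openin (top_of_set X) T \<and> m \<in> T \<and> T \<subseteq> S" by blast
  qed
  moreover have "openin (top_of_set X) (X - S)"
    unfolding openin_subopen[of _ "X - S"]
  proof
    fix m assume m: "m \<in> X - S"
    then obtain N where N: "openin (top_of_set X) N" "m \<in> N" "\<forall>z\<in>N. z \<in> S \<longleftrightarrow> m \<in> S" using nbhd by blast
    moreover have "N \<subseteq> X" using N(1) by (rule openin_imp_subset)
    ultimately show "\<exists>T. openin (top_of_set X) T \<and> m \<in> T \<and> T \<subseteq> X - S" using m by blast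
  qed
  then have "closedin (top_of_set X) S" by (auto simp: closedin_def S_def)
  moreover have "x0 \<in> S"
    using const_in_paths[OF x0] x0 by (auto simp: S_def pathstart_def pathfinish_def)
  ultimately have "S = X" using assms(1) unfolding connected_clopen by blast
  with x that show thesis by (auto simp: S_def)
qed

text \<open>
  The weights are built from bumps by \<open>\<rho>\<^sub>k = \<beta>\<^sub>k \<Prod>\<^sub>j\<^sub><\<^sub>k (1 - \<beta>\<^sub>j)\<close>; since \<open>\<rho>\<^sub>k\<close> vanishes where some earlier \<open>\<beta>\<^sub>j\<close>
  equals \<open>1\<close>, they sum to \<open>1\<close> and are locally finite without any appeal to paracompactness.
\<close>

lemma return_paths_exist:
  assumes conn: "connected X" and x0: "x0 \<in> X"
  shows "\<exists>(\<rho> :: nat \<Rightarrow> 'a \<Rightarrow> complex) (R :: nat \<Rightarrow> 'a \<Rightarrow> real \<Rightarrow> 'a) (n :: 'a \<Rightarrow> nat).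
    (\<forall>m\<in>X. (\<Sum>k\<le>n m. \<rho> k m) = 1) \<and>
    (\<forall>k m. \<rho> k m \<noteq> 0 \<longrightarrow> R k m \<in> paths X A \<and> pathstart (R k m) = m \<and> pathfinish (R k m) = x0) \<and>
    (\<forall>k. \<rho> k x0 \<noteq> 0 \<longrightarrow> R k x0 = (\<lambda>_. x0)) \<and>
    (\<forall>ws. set ws \<subseteq> smooth_forms E A \<longrightarrow> smooth_fun (\<lambda>m. \<Sum>k\<le>n m. \<rho> k m * iint ws (R k m)))"
proof -
  have "X \<noteq> {}" using x0 by blast
  from countable_chart_ball_cover[OF this] obtain U \<phi> c r
    where u': "\<forall>k::nat. (U k, \<phi> k) \<in> A \<and> c k \<in> E \<and> 0 < r k \<and> ball (c k) (r k) \<inter> E \<subseteq> \<phi> k ` U k"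
      and XV: "X = (\<Union>k. chart_ball (U k) (\<phi> k) (c k) (r k / 2))" by (elim exE conjE)
  have u: "\<And>k. (U k, \<phi> k) \<in> A" "\<And>k. c k \<in> E" "\<And>k. 0 < r k" "\<And>k. ball (c k) (r k) \<inter> E \<subseteq> \<phi> k ` U k"
    using u' by blast+
  define V where "V k = chart_ball (U k) (\<phi> k) (c k) (r k / 2)" for k
  define B where "B k = chart_ball (U k) (\<phi> k) (c k) (r k)" for k
  define \<beta> where "\<beta> k = cutoff (U k) (\<phi> k) (c k) (r k)" for k
  define \<rho> where "\<rho> k m = \<beta> k m * (\<Prod>j<k. 1 - \<beta> j m)" for k m
  \<comment> \<open>The first half-radius ball containing m: its bump equals 1 at m, so all later
    weights vanish there.\<close>
  define n where "n m = (LEAST k. m \<in> V k)" for m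
  have nV: "m \<in> V (n m)" if "m \<in> X" for m
    using that LeastI_ex[of "\<lambda>k. m \<in> V k"] XV unfolding n_def V_def by blast
  have \<beta>1: "\<beta> k m = 1" if "m \<in> V k" for k m using that u(3) by (simp add: \<beta>_def V_def cutoff_eq_1)
  have \<rho>B: "m \<in> B k" if "\<rho> k m \<noteq> 0" for k m
  proof (rule ccontr)
    assume "m \<notin> B k"
    then have "\<beta> k m = 0" unfolding \<beta>_def B_def by (rule cutoff_eq_0[OF u(3)])
    with that show False by (simp add: \<rho>_def)
  qed
  \<comment> \<open>The sum telescopes, and the product vanishes as soon as one bump equals
    1.\<close>
  have sum\<rho>: "(\<Sum>k\<le>j. \<rho> k m) = 1 - (\<Prod>i\<le>j. 1 - \<beta> i m)" for j m
  proof (induction j)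
    case (Suc j)
    have "\<rho> (Suc j) m = \<beta> (Suc j) m * (\<Prod>i\<le>j. 1 - \<beta> i m)" by (simp only: \<rho>_def lessThan_Suc_atMost)
    with Suc show ?case by (simp add: algebra_simps)
  qed (simp add: \<rho>_def)
  have \<rho>0: "\<rho> k m = 0" if "m \<in> V j" "j < k" for j k m
    using that \<beta>1[OF that(1)] by (auto simp: \<rho>_def)

  \<comment> \<open>Each ball gets a target e and a fixed path \<sigma> from there to x0. If x0 lies
    in the ball, the target is x0 itself and \<sigma> is constant, which makes the return path from
    x0 constant.\<close>
  have "\<exists>e \<sigma>. e \<in> ball (c k) (r k) \<inter> E \<and> \<sigma> \<in> paths X A \<and> pathstart \<sigma> = inv_into (U k) (\<phi> k) e \<and>
      pathfinish \<sigma> = x0 \<and> (x0 \<in> B k \<longrightarrow> e = \<phi> k x0 \<and> \<sigma> = (\<lambda>_. x0))" for k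
  proof (cases "x0 \<in> B k")
    case True
    then have "x0 \<in> U k" "\<phi> k x0 \<in> ball (c k) (r k) \<inter> E"
      using chart(5)[OF u(1)[of k]] by (auto simp: B_def chart_ball_def)
    then show ?thesis
      using const_in_paths[OF x0] chart_inv[OF u(1)]
      by (intro exI[of _ "\<phi> k x0"] exI[of _ "\<lambda>_. x0"]) (simp add: pathstart_def pathfinish_def)
  next
    case False
    have e: "c k \<in> ball (c k) (r k) \<inter> E" using u(2,3) by simp
    then have "inv_into (U k) (\<phi> k) (c k) \<in> X"
      using u(4)[of k] chart(4)[OF u(1)[of k]] inv_into_into[of "c k" "\<phi> k" "U k"] by blast
    from smooth_path_connected[OF conn x0 this] obtain \<sigma>
      where "\<sigma> \<in> paths X A" "pathstart \<sigma> = inv_into (U k) (\<phi> k) (c k)" "pathfinish \<sigma> = x0" .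
    with e False show ?thesis by blast
  qed
  then obtain e \<sigma> where "\<forall>k. e k \<in> ball (c k) (r k) \<inter> E \<and> \<sigma> k \<in> paths X A \<and>
      pathstart (\<sigma> k) = inv_into (U k) (\<phi> k) (e k) \<and> pathfinish (\<sigma> k) = x0 \<and>
      (x0 \<in> B k \<longrightarrow> e k = \<phi> k x0 \<and> \<sigma> k = (\<lambda>_. x0))"
    by metis
  then have e\<sigma>: "\<And>k. e k \<in> ball (c k) (r k) \<inter> E" "\<And>k. \<sigma> k \<in> paths X A"
      "\<And>k. pathstart (\<sigma> k) = inv_into (U k) (\<phi> k) (e k)" "\<And>k. pathfinish (\<sigma> k) = x0"
      "\<And>k. x0 \<in> B k \<Longrightarrow> e k = \<phi> k x0 \<and> \<sigma> k = (\<lambda>_. x0)"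
    by blast+
  define l where "l k y = line_path (U k) (\<phi> k) y (e k)" for k y
  have l: "l k y \<in> paths X A" "pathfinish (l k y) = pathstart (\<sigma> k)" "pathstart (l k y) = inv_into (U k) (\<phi> k) y"
    if "y \<in> ball (c k) (r k) \<inter> E" for k y
    using line_path_in_paths[OF u(1,4) that e\<sigma>(1)] by (simp_all add: l_def line_path_ends e\<sigma>(3))
  \<comment> \<open>Only the segment depends on m. Through the composition formula, smooth
    dependence on m reduces to \<open>Ck_on_iint_line_path\<close>.\<close>
  define R where "R k m = smooth_join (l k (\<phi> k m)) (\<sigma> k)" for k m
  have \<phi>B: "m \<in> U k" "\<phi> k m \<in> ball (c k) (r k) \<inter> E" if "m \<in> B k" for k m
    using that chart(5)[OF u(1)[of k]] by (auto simp: B_def chart_ball_def)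

  have "R k m \<in> paths X A \<and> pathstart (R k m) = m \<and> pathfinish (R k m) = x0" if "\<rho> k m \<noteq> 0" for k m
  proof -
    note m = \<phi>B[OF \<rho>B[OF that]]
    show ?thesis
      using smooth_join_in_paths[OF l(1)[OF m(2)] e\<sigma>(2) l(2)[OF m(2)]] l(3)[OF m(2)] chart_inv[OF u(1) m(1)]
      by (simp add: R_def smooth_join_ends e\<sigma>(4))
  qed
  moreover have "(\<Sum>k\<le>n m. \<rho> k m) = 1" if "m \<in> X" for m
    using \<beta>1[OF nV[OF that]] by (auto simp: sum\<rho> intro!: bexI[of _ "n m"])
  moreover have "R k x0 = (\<lambda>_. x0)" if "\<rho> k x0 \<noteq> 0" for k
  proof -
    have "l k (\<phi> k x0) = (\<lambda>_. x0)"
      using e\<sigma>(5)[OF \<rho>B[OF that]] chart_inv[OF u(1) \<phi>B(1)[OF \<rho>B[OF that]]] by (auto simp: l_def line_path_def)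
    then show ?thesis
      using e\<sigma>(5)[OF \<rho>B[OF that]] by (simp add: R_def smooth_join_def joinpaths_def)
  qed
  moreover have "smooth_fun (\<lambda>m. \<Sum>k\<le>n m. \<rho> k m * iint ws (R k m))" if ws: "set ws \<subseteq> smooth_forms E A" for ws
  proof -
    have "Ck_on k' (ball (c k) (r k) \<inter> E) (\<lambda>y. iint ws (R k (inv_into (U k) (\<phi> k) y)))" for k k'
    proof (rule Ck_on_cong)
      show "Ck_on k' (ball (c k) (r k) \<inter> E) (\<lambda>y. \<Sum>j\<le>length ws. iint (take j ws) (\<sigma> k) * iint (drop j ws) (l k y))"
        unfolding l_def
        by (intro Ck_on_sum Ck_on_mult Ck_on_const Ck_on_iint_line_path[OF u(1,4) e\<sigma>(1)])
           (rule subset_trans[OF set_drop_subset ws])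
      fix y assume y: "y \<in> ball (c k) (r k) \<inter> E"
      then have "\<phi> k (inv_into (U k) (\<phi> k) y) = y" using u(4) by (intro f_inv_into_f) blast
      then show "(\<Sum>j\<le>length ws. iint (take j ws) (\<sigma> k) * iint (drop j ws) (l k y)) =
          iint ws (R k (inv_into (U k) (\<phi> k) y))"
        using iint_smooth_join[OF ws l(1)[OF y] e\<sigma>(2) l(2)[OF y]] by (simp add: R_def)
    qed
    then have sm: "smooth_fun (\<lambda>m. \<beta> k m * iint ws (R k m))" for k
      unfolding \<beta>_def by (rule smooth_fun_cutoff_mult[OF u(1,3,4)])
    have "Ck_on k' (ball (c k) (r k) \<inter> E) (\<lambda>y. 1::complex)" for k k' by (rule Ck_on_const)
    from smooth_fun_cutoff_mult[OF u(1,3,4) this] have "smooth_fun (\<beta> k)" for k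
      by (simp add: \<beta>_def)
    then have "smooth_fun (\<lambda>m. (\<Prod>j<k. 1 - \<beta> j m) * (\<beta> k m * iint ws (R k m)))" for k
      by (intro smooth_fun_mult smooth_fun_prod smooth_fun_diff smooth_fun_const sm)
    then have sk: "smooth_fun (\<lambda>m. \<rho> k m * iint ws (R k m))" for k
      by (simp add: \<rho>_def mult_ac)
    show ?thesis
    proof (rule smooth_fun_locally_eq)
      fix m assume m: "m \<in> X"
      \<comment> \<open>The number of terms depends on the point, but on \<open>V (n m)\<close> it
        never exceeds the number at m, and the surplus terms have weight 0.\<close>
      have eq: "(\<Sum>k\<le>n m'. \<rho> k m' * iint ws (R k m')) = (\<Sum>k\<le>n m. \<rho> k m' * iint ws (R k m'))"
        if m': "m' \<in> V (n m)" for m'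
      proof (rule sum.mono_neutral_left)
        have "m' \<in> X" using m' XV unfolding V_def by blast
        moreover have "n m' \<le> n m" unfolding n_def[of m'] by (rule Least_le) (rule m')
        ultimately show "{..n m'} \<subseteq> {..n m}" "\<forall>i\<in>{..n m} - {..n m'}. \<rho> i m' * iint ws (R i m') = 0"
          using \<rho>0[OF nV] by auto
      qed auto
      show "\<exists>N b. openin (top_of_set X) N \<and> m \<in> N \<and> smooth_fun b \<and>
          (\<forall>m\<in>N. (\<Sum>k\<le>n m. \<rho> k m * iint ws (R k m)) = b m)"
      proof (intro exI conjI ballI)
        show "openin (top_of_set X) (V (n m))" unfolding V_def by (rule openin_chart_ball[OF u(1)])
        show "m \<in> V (n m)" by (rule nV[OF m])
        show "smooth_fun (\<lambda>m'. \<Sum>k\<le>n m. \<rho> k m' * iint ws (R k m'))" by (intro smooth_fun_sum sk)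
      qed (rule eq)
    qed
  qed
  ultimately show ?thesis
    by (intro exI[of _ \<rho>] exI[of _ R] exI[of _ n] conjI ballI allI impI) blast+
qed

section \<open>The extension of a homotopy invariant function\<close>

text \<open>The space of length s in a form convenient for closure properties: sums become appended
  lists. Equality is asked only on paths from x0, where functions of the start-point are
  constants.\<close>

definition iint_span :: "'a \<Rightarrow> nat \<Rightarrow> ((real \<Rightarrow> 'a) \<Rightarrow> complex) set" where
  "iint_span x0 s = {g. \<exists>L. (\<forall>x\<in>set L. length (snd x) \<le> s \<and> set (snd x) \<subseteq> smooth_forms E A) \<and>
     (\<forall>p\<in>paths_from X A x0. g p = (\<Sum>(c, ws)\<leftarrow>L. c * iint ws p))}"

lemma iint_span_zero: "(\<lambda>p. 0) \<in> iint_span x0 s"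
  unfolding iint_span_def by (auto intro!: exI[of _ "[]"])

lemma iint_span_iint: "length ws \<le> s \<Longrightarrow> set ws \<subseteq> smooth_forms E A \<Longrightarrow> iint ws \<in> iint_span x0 s"
  unfolding iint_span_def by (auto intro!: exI[of _ "[(1, ws)]"])

lemma iint_span_add:
  assumes "f \<in> iint_span x0 s" "g \<in> iint_span x0 s"
  shows "(\<lambda>p. f p + g p) \<in> iint_span x0 s"
proof -
  obtain L M where
    "\<forall>x\<in>set L. length (snd x) \<le> s \<and> set (snd x) \<subseteq> smooth_forms E A"
    "\<forall>p\<in>paths_from X A x0. f p = (\<Sum>(c, ws)\<leftarrow>L. c * iint ws p)"
    "\<forall>x\<in>set M. length (snd x) \<le> s \<and> set (snd x) \<subseteq> smooth_forms E A"
    "\<forall>p\<in>paths_from X A x0. g p = (\<Sum>(c, ws)\<leftarrow>M. c * iint ws p)"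
    using assms unfolding iint_span_def by blast
  then show ?thesis unfolding iint_span_def
    by (intro CollectI exI[of _ "L @ M"] conjI) (simp_all add: ball_Un)
qed

lemma iint_span_scale:
  assumes "f \<in> iint_span x0 s"
  shows "(\<lambda>p. a * f p) \<in> iint_span x0 s"
proof -
  obtain L where L:
    "\<forall>x\<in>set L. length (snd x) \<le> s \<and> set (snd x) \<subseteq> smooth_forms E A"
    "\<forall>p\<in>paths_from X A x0. f p = (\<Sum>(c, ws)\<leftarrow>L. c * iint ws p)"
    using assms unfolding iint_span_def by blast
  have "a * (\<Sum>(c, ws)\<leftarrow>L. c * iint ws p) = (\<Sum>(c, ws)\<leftarrow>map (\<lambda>(c, ws). (a * c, ws)) L. c * iint ws p)" for p
    by (induction L) (auto simp: algebra_simps)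
  with L show ?thesis unfolding iint_span_def
    by (intro CollectI exI[of _ "map (\<lambda>(c, ws). (a * c, ws)) L"] conjI) (simp_all add: case_prod_unfold)
qed

lemma iint_span_sum: "(\<And>i. i \<in> I \<Longrightarrow> f i \<in> iint_span x0 s) \<Longrightarrow> (\<lambda>p. \<Sum>i\<in>I. f i p) \<in> iint_span x0 s"
  by (induction I rule: infinite_finite_induct) (auto intro: iint_span_zero iint_span_add)

lemma iint_span_cong:
  assumes "f \<in> iint_span x0 s" "\<And>p. p \<in> paths_from X A x0 \<Longrightarrow> g p = f p"
  shows "g \<in> iint_span x0 s"
  using assms unfolding iint_span_def by auto

text \<open>Integration by parts adds the letter da, for which the strict bound on the length leaves
  room. For the empty word, a(p 1) is a(x0) plus the integral of da along p; here the common
  start-point enters.\<close>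

lemma iint_span_mult_endpoint:
  assumes a: "smooth_fun a" and ws: "set ws \<subseteq> smooth_forms E A" "length ws < s"
  shows "(\<lambda>p. a (p 1) * iint ws p) \<in> iint_span x0 s"
proof (cases ws)
  case Nil
  have "(\<lambda>p. a x0 * iint [] p + iint [exterior_derivative a] p) \<in> iint_span x0 s"
    using ws exterior_derivative_smooth_form[OF a]
    by (intro iint_span_add iint_span_scale iint_span_iint) auto
  then show ?thesis
  proof (rule iint_span_cong)
    fix p assume "p \<in> paths_from X A x0"
    then have "p \<in> paths X A" "p 0 = x0" by (auto simp: paths_from_def pathstart_def)
    then show "a (p 1) * iint ws p = a x0 * iint [] p + iint [exterior_derivative a] p"
      using iint_exterior_derivative[OF a] Nil by (simp add: iint_def[of "[]"])
  qed
next
  case (Cons v vs)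
  have "(\<lambda>p. iint (exterior_derivative a # v # vs) p + iint (form_scale a v # vs) p) \<in> iint_span x0 s"
    using ws Cons exterior_derivative_smooth_form[OF a] form_scale_smooth_form[OF a]
    by (intro iint_span_add iint_span_iint) auto
  then show ?thesis
  proof (rule iint_span_cong)
    fix p assume "p \<in> paths_from X A x0"
    then have "p \<in> paths X A" by (auto simp: paths_from_def)
    from iint_mult_endpoint[OF a this] ws Cons
    show "a (p 1) * iint ws p = iint (exterior_derivative a # v # vs) p + iint (form_scale a v # vs) p" by simp
  qed
qed

lemma iint_span_B_from:
  assumes "g \<in> iint_span x0 s"
  shows "restrict g (paths_from X A x0) \<in> B_from E X A s x0"
proof -
  obtain L where L: "\<forall>x\<in>set L. length (snd x) \<le> s \<and> set (snd x) \<subseteq> smooth_forms E A"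
    "\<forall>p\<in>paths_from X A x0. g p = (\<Sum>(c, ws)\<leftarrow>L. c * iint ws p)"
    using assms unfolding iint_span_def by blast
  define F where "F = restrict (\<lambda>p. \<Sum>i<length L. fst (L ! i) * iterated_integral A (rev (snd (L ! i))) p) (paths X A)"
  have "length (rev (snd (L ! i))) \<le> s \<and> set (rev (snd (L ! i))) \<subseteq> smooth_forms E A" if "i < length L" for i
    using L(1) nth_mem[OF that] by (auto simp: case_prod_unfold)
  then have "F \<in> B_paths E X A s"
    unfolding B_paths_def F_def
    by (intro CollectI exI[of _ "length L"] exI[of _ "\<lambda>i. fst (L ! i)"] exI[of _ "\<lambda>i. rev (snd (L ! i))"]) auto
  moreover have "restrict g (paths_from X A x0) = restrict F (paths_from X A x0)"
  proof (rule restrict_ext)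
    fix p assume p: "p \<in> paths_from X A x0"
    have "g p = (\<Sum>i<length L. fst (L ! i) * iint (snd (L ! i)) p)"
      using L(2) p by (simp add: sum_list_sum_nth case_prod_unfold atLeast0LessThan)
    then show "g p = F p" using p by (simp add: F_def paths_from_def iterated_integral_eq_iint)
  qed
  ultimately show ?thesis unfolding B_from_def by blast
qed

lemma extend_homotopy_invariant:
  assumes conn: "connected X" and x0: "x0 \<in> X" and F: "F \<in> B_loops_hom E X A s x0"
  shows "F \<in> (\<lambda>F. restrict F (loops_at X A x0)) ` B_from_hom E X A s x0"
proof -
  obtain F' where F': "F' \<in> B_paths E X A s" "F = restrict F' (loops_at X A x0)"
    using F unfolding B_loops_hom_def B_loops_def by blast
  then obtain N c w where w': "\<forall>i<(N::nat). length (w i) \<le> s \<and> set (w i) \<subseteq> smooth_forms E A"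
    and F'_eq: "F' = restrict (\<lambda>p. \<Sum>i<N. c i * iterated_integral A (w i) p) (paths X A)"
    unfolding B_paths_def mem_Collect_eq by (elim exE conjE)
  have w: "length (w i) \<le> s \<and> set (w i) \<subseteq> smooth_forms E A" if "i < N" for i using w' that by blast
  note F_eq = F'(2)[unfolded F'_eq]
  have loops: "loops_at X A x0 \<subseteq> paths_from X A x0" "paths_from X A x0 \<subseteq> paths X A"
    by (auto simp: loops_at_def paths_from_def)
  \<comment> \<open>A fixed representative of F, defined on all paths. Its homotopy invariance is
    known on loops at x0 alone, so every value that counts below is taken on a closed-up
    path.\<close>
  define I where "I p = (\<Sum>i<N. c i * iint (rev (w i)) p)" for p
  have F_I: "F p = I p" if "p \<in> loops_at X A x0" for p
    using that loops by (auto simp: F_eq I_def iterated_integral_eq_iint)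
  have I_inv: "I p = I q" if "p \<in> loops_at X A x0" "q \<in> loops_at X A x0" "homotopic_paths X p q" for p q
    using F that F_I unfolding B_loops_hom_def homotopy_invariant_def by auto
  from return_paths_exist[OF conn x0] obtain \<rho> :: "nat \<Rightarrow> 'a \<Rightarrow> complex" and R :: "nat \<Rightarrow> 'a \<Rightarrow> real \<Rightarrow> 'a" and n :: "'a \<Rightarrow> nat"
    where \<rho>1: "\<forall>m\<in>X. (\<Sum>k\<le>n m. \<rho> k m) = 1"
      and R': "\<forall>k m. \<rho> k m \<noteq> 0 \<longrightarrow> R k m \<in> paths X A \<and> pathstart (R k m) = m \<and> pathfinish (R k m) = x0"
      and R0': "\<forall>k. \<rho> k x0 \<noteq> 0 \<longrightarrow> R k x0 = (\<lambda>_. x0)"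
      and sm: "\<forall>ws. set ws \<subseteq> smooth_forms E A \<longrightarrow> smooth_fun (\<lambda>m. \<Sum>k\<le>n m. \<rho> k m * iint ws (R k m))"
    by (elim exE conjE)
  have R: "R k m \<in> paths X A \<and> pathstart (R k m) = m \<and> pathfinish (R k m) = x0" if "\<rho> k m \<noteq> 0" for k m
    using R' that by blast
  have R0: "R k x0 = (\<lambda>_. x0)" if "\<rho> k x0 \<noteq> 0" for k using R0' that by blast
  define G where "G p = (\<Sum>k\<le>n (p 1). \<rho> k (p 1) * I (smooth_join p (R k (p 1))))" for p
  have join_loop: "smooth_join p (R k (p 1)) \<in> loops_at X A x0"
      "homotopic_paths X (p +++ R k (p 1)) (smooth_join p (R k (p 1)))"
    if p: "p \<in> paths_from X A x0" and k: "\<rho> k (p 1) \<noteq> 0" for p k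
  proof -
    have p': "p \<in> paths X A" "pathstart p = x0" using p by (auto simp: paths_from_def)
    have r: "R k (p 1) \<in> paths X A" "pathfinish p = pathstart (R k (p 1))" "pathfinish (R k (p 1)) = x0"
      using R[OF k] by (auto simp: pathfinish_def)
    show "smooth_join p (R k (p 1)) \<in> loops_at X A x0"
      using smooth_join_in_paths[OF p'(1) r(1,2)] p' r by (simp add: loops_at_def smooth_join_ends)
    show "homotopic_paths X (p +++ R k (p 1)) (smooth_join p (R k (p 1)))"
      by (rule homotopic_smooth_join[OF pathsD(1)[OF p'(1)] pathsD(1)[OF r(1)] pathsD(2)[OF p'(1)] pathsD(2)[OF r(1)] r(2)])
  qed
  have G_loops: "G p = F p" if p: "p \<in> loops_at X A x0" for p
  proof -
    have p': "p \<in> paths X A" "p 1 = x0" "p \<in> paths_from X A x0"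
      using p loops by (auto simp: loops_at_def pathfinish_def)
    have "\<rho> k x0 * I (smooth_join p (R k x0)) = \<rho> k x0 * I p" for k
    \<comment> \<open>A nonzero weight forces the return path from x0 to be constant, so closing up
      p gives a loop homotopic to p.\<close>
    proof (cases "\<rho> k x0 = 0")
      case False
      have "homotopic_paths X p (smooth_join p (R k x0))"
        using homotopic_smooth_join_const[OF pathsD(1,2)[OF p'(1)]] R0[OF False] p'(2)
        by (simp add: pathfinish_def)
      from I_inv[OF p _ this] show ?thesis
        using join_loop(1)[OF p'(3)] False p'(2) by simp
    qed simp
    then have "G p = (\<Sum>k\<le>n x0. \<rho> k x0) * I p"
      by (simp only: G_def p'(2) sum_distrib_right)
    then show ?thesis using bspec[OF \<rho>1 x0] F_I[OF p] by simp
  qed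
  have G_inv: "G p = G q"
    if p: "p \<in> paths_from X A x0" and q: "q \<in> paths_from X A x0" and pq: "homotopic_paths X p q" for p q
  proof -
    \<comment> \<open>The common end-point gives p and q the same weights, return paths and number
      of terms.\<close>
    have e: "p 1 = q 1" using homotopic_paths_imp_pathfinish[OF pq] by (simp add: pathfinish_def)
    have "\<rho> k (p 1) * I (smooth_join p (R k (p 1))) = \<rho> k (p 1) * I (smooth_join q (R k (p 1)))" for k
    proof (cases "\<rho> k (p 1) = 0")
      case False
      then have False': "\<rho> k (q 1) \<noteq> 0" by (simp add: e)
      note jp = join_loop[OF p False] and jq = join_loop[OF q False', folded e]
      have "homotopic_paths X (R k (p 1)) (R k (p 1))"
        using R[OF False] pathsD(1,2) by (simp add: homotopic_paths_refl)
      then have "homotopic_paths X (p +++ R k (p 1)) (q +++ R k (p 1))"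
        by (rule homotopic_paths_join[OF pq]) (use R[OF False] in \<open>simp add: pathfinish_def\<close>)
      then have "homotopic_paths X (smooth_join p (R k (p 1))) (smooth_join q (R k (p 1)))"
        using jp(2) jq(2) homotopic_paths_sym homotopic_paths_trans by blast
      from I_inv[OF jp(1) jq(1) this] show ?thesis by simp
    qed simp
    then show ?thesis by (simp only: G_def e)
  qed
  \<comment> \<open>The coefficients that the composition formula leaves at the end-point: weighted
    averages of iterated integrals over the return paths, smooth by the choice of the
    family.\<close>
  define a where "a ws m = (\<Sum>k\<le>n m. \<rho> k m * iint ws (R k m))" for ws m
  have G_eq: "G p = (\<Sum>i<N. c i * (\<Sum>j\<le>length (w i). a (take j (rev (w i))) (p 1) * iint (drop j (rev (w i))) p))"
    if p: "p \<in> paths_from X A x0" for p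
  proof -
    let ?m = "p 1"
    have "\<rho> k ?m * I (smooth_join p (R k ?m)) = (\<Sum>i<N. c i * (\<Sum>j\<le>length (w i).
        (\<rho> k ?m * iint (take j (rev (w i))) (R k ?m)) * iint (drop j (rev (w i))) p))" for k
    proof (cases "\<rho> k ?m = 0")
      case False
      have "iint (rev (w i)) (smooth_join p (R k ?m)) =
          (\<Sum>j\<le>length (w i). iint (take j (rev (w i))) (R k ?m) * iint (drop j (rev (w i))) p)" if "i < N" for i
        using iint_smooth_join[of "rev (w i)" p "R k ?m"] w[OF that] p loops(2) R[OF False]
        by (auto simp: pathfinish_def)
      then show ?thesis
        by (simp add: I_def sum_distrib_left mult_ac)
    qed simp
    then have "G p = (\<Sum>k\<le>n ?m. \<Sum>i<N. c i * (\<Sum>j\<le>length (w i).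
        (\<rho> k ?m * iint (take j (rev (w i))) (R k ?m)) * iint (drop j (rev (w i))) p))"
      by (simp add: G_def)
    also have "\<dots> = (\<Sum>i<N. \<Sum>k\<le>n ?m. c i * (\<Sum>j\<le>length (w i).
        (\<rho> k ?m * iint (take j (rev (w i))) (R k ?m)) * iint (drop j (rev (w i))) p))"
      by (rule sum.swap)
    also have "\<dots> = (\<Sum>i<N. c i * (\<Sum>j\<le>length (w i). \<Sum>k\<le>n ?m.
        (\<rho> k ?m * iint (take j (rev (w i))) (R k ?m)) * iint (drop j (rev (w i))) p))"
      unfolding sum_distrib_left[symmetric] by (subst sum.swap) simp
    finally show ?thesis by (simp add: a_def sum_distrib_right)
  qed
  have summand: "(\<lambda>p. a (take j ws) (p 1) * iint (drop j ws) p) \<in> iint_span x0 s"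
    if ws: "set ws \<subseteq> smooth_forms E A" "length ws \<le> s" and j: "j \<le> length ws" for ws j
  \<comment> \<open>The word that stays on p has length at most s - j. For j = 0 there may be no
    room for a further letter, but the coefficient is the sum of the weights.\<close>
  proof (cases "j = 0")
    case True
    have "iint ws \<in> iint_span x0 s" by (rule iint_span_iint[OF ws(2,1)])
    then show ?thesis
    proof (rule iint_span_cong)
      fix p assume "p \<in> paths_from X A x0"
      then have "p 1 \<in> X" using loops(2) pathsD(3)[of p 1] by auto
      then have "a [] (p 1) = 1" using \<rho>1 by (simp add: a_def iint_def)
      with True show "a (take j ws) (p 1) * iint (drop j ws) p = iint ws p" by simp
    qed
  next
    case False
    have "set (take j ws) \<subseteq> smooth_forms E A" "set (drop j ws) \<subseteq> smooth_forms E A"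
      using ws(1) set_take_subset set_drop_subset by fast+
    moreover have "length (drop j ws) < s" using False j ws(2) by simp
    ultimately show ?thesis
      using sm unfolding a_def by (intro iint_span_mult_endpoint) auto
  qed
  have "(\<lambda>p. \<Sum>i<N. c i * (\<Sum>j\<le>length (w i). a (take j (rev (w i))) (p 1) * iint (drop j (rev (w i))) p))
      \<in> iint_span x0 s"
    using w by (intro iint_span_sum iint_span_scale summand) auto
  then have "G \<in> iint_span x0 s" using G_eq by (rule iint_span_cong)
  then have "restrict G (paths_from X A x0) \<in> B_from E X A s x0" by (rule iint_span_B_from)
  then have "restrict G (paths_from X A x0) \<in> B_from_hom E X A s x0"
    using G_inv by (auto simp: B_from_hom_def homotopy_invariant_def)
  \<comment> \<open>The equality is one of total functions; off the loops both sides are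
    \<open>undefined\<close>, since F is itself a restriction.\<close>
  moreover have "F = restrict (restrict G (paths_from X A x0)) (loops_at X A x0)"
  proof
    fix p
    show "F p = restrict (restrict G (paths_from X A x0)) (loops_at X A x0) p"
      using G_loops loops(1) by (cases "p \<in> loops_at X A x0") (auto simp: F_eq)
  qed
  ultimately show ?thesis by blast
qed

end

text \<open>Besides surjectivity, the image equality of the theorem contains that restriction maps
  into the target. A loop is in particular a path from x0, so invariance is inherited.\<close>

lemma restrict_B_from_hom:
  assumes "F \<in> B_from_hom E X A s x0"
  shows "restrict F (loops_at X A x0) \<in> B_loops_hom E X A s x0"
proof -
  have loops: "loops_at X A x0 \<subseteq> paths_from X A x0" by (auto simp: loops_at_def paths_from_def)
  obtain F' where "F' \<in> B_paths E X A s" "F = restrict F' (paths_from X A x0)"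
    using assms by (auto simp: B_from_hom_def B_from_def)
  moreover from this have "restrict F (loops_at X A x0) = restrict F' (loops_at X A x0)"
    using loops by (auto simp: Int_absorb1)
  ultimately have "restrict F (loops_at X A x0) \<in> B_loops E X A s x0"
    by (auto simp: B_loops_def)
  then show ?thesis
    using assms loops by (auto simp: B_loops_hom_def B_from_hom_def homotopy_invariant_def subset_iff)
qed

theorem theorem2p1:
  fixes E :: "'e::euclidean_space set"
    and X :: "'a::{t2_space, second_countable_topology} set"
    and A :: "('a, 'e) chart set"
    and x0 :: 'a and s :: nat
  assumes "smooth_manifold E X A" and "connected X" and "x0 \<in> X"
  shows "(\<lambda>F. restrict F (loops_at X A x0)) ` B_from_hom E X A s x0 = B_loops_hom E X A s x0"
proof -
  have "subspace E" using assms(1) by (simp add: smooth_manifold_def)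
  from tangent_projection_subspace[OF this] obtain P
    where "tangent_projection E P \<and> (\<forall>v. P v \<in> E) \<and> (\<forall>v\<in>E. P v = v)" by blast
  with assms(1) interpret projected_manifold E X A P
    by unfold_locales blast+
  show ?thesis
    using restrict_B_from_hom extend_homotopy_invariant[OF assms(2,3)] by blast
qed

end
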